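(* Let $I\subset S=K[x_1,\ldots,x_n]$ be a nonzero proper monomial ideal of Borel type and let $q$ be a positive integer. Then $$\operatorname{reg}(I^{[q]})\geq q\cdot \operatorname{reg}(I),$$ where $I^{[q]}$ is the $q$-th bracket power of $I$.
   Context: $K$ is an infinite field and $S=K[x_1,\ldots,x_n]$, $n\geq 2$, is the polynomial ring with the standard grading. Borel type: a monomial ideal $I\subset S$ is of Borel type if $(I:x_j^\infty)=(I:(x_1,\ldots,x_j)^\infty)$ for all $j=1,\ldots,n$, where $(I:J^\infty)=\bigcup_{k\ge 0}(I:J^k)$. Bracket power: for a monomial ideal $I$, $I^{[q]}$ is the ideal generated by all $u^q$ with $u\in I$ a monomial. Regularity: for a finitely generated graded $S$-module $M$, $\operatorname{reg}(M)=\max_{i,j}\{j-i:\beta_{ij}(M)\neq 0\}$, where $\beta_{ij}(M)=\dim_K \operatorname{Tor}_i^S(K,M)_j$. Here $\operatorname{reg}(I)$ is the regularity of the ideal $I$ as an $S$-module. *)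

theory Defs
  imports Complex_Main "HOL-Library.Cardinality" "HOL-Library.Function_Algebras"
    "HOL-Library.Poly_Mapping"
begin

text \<open>
  \<open>('n, 'k) mpoly\<close> is the polynomial ring over \<open>'k\<close> with one variable for each element of
  \<open>'n\<close>. Throughout, \<open>'n\<close> is a finite linearly ordered type; listing its elements in increasing
  order gives the variables \<open>x_1, \<dots>, x_n\<close> with \<open>n = CARD('n)\<close>.
\<close>

type_synonym ('n, 'k) mpoly = "('n \<Rightarrow>\<^sub>0 nat) \<Rightarrow>\<^sub>0 'k"

definition monom :: "('n \<Rightarrow>\<^sub>0 nat) \<Rightarrow> ('n, 'k::zero_neq_one) mpoly"
  where "monom a = Poly_Mapping.single a 1"

definition var :: "'n \<Rightarrow> ('n, 'k::zero_neq_one) mpoly"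
  where "var i = monom (Poly_Mapping.single i 1)"

definition const :: "'k \<Rightarrow> ('n, 'k::zero) mpoly"
  where "const c = Poly_Mapping.single 0 c"

definition deg :: "('n::finite \<Rightarrow>\<^sub>0 nat) \<Rightarrow> nat"
  where "deg a = (\<Sum>i\<in>UNIV. Poly_Mapping.lookup a i)"

text \<open>The component of degree \<open>d\<close> in the standard grading; it is \<open>{0}\<close> for \<open>d < 0\<close>.\<close>

definition homogeneous :: "int \<Rightarrow> ('n::finite, 'k::zero) mpoly set"
  where "homogeneous d = {p. \<forall>a\<in>Poly_Mapping.keys p. int (deg a) = d}"


section \<open>Ideals\<close>

abbreviation ideal_gen :: "'a::comm_ring_1 set \<Rightarrow> 'a set"
  where "ideal_gen \<equiv> module.span (*)"

definition ideal_mult :: "'a::comm_ring_1 set \<Rightarrow> 'a set \<Rightarrow> 'a set"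
  where "ideal_mult I J = ideal_gen {a * b | a b. a \<in> I \<and> b \<in> J}"

primrec ideal_power :: "'a::comm_ring_1 set \<Rightarrow> nat \<Rightarrow> 'a set" where
  "ideal_power J 0 = UNIV"
| "ideal_power J (Suc k) = ideal_mult J (ideal_power J k)"

definition colon :: "'a::comm_ring_1 set \<Rightarrow> 'a set \<Rightarrow> 'a set"
  where "colon I J = {f. \<forall>g\<in>J. f * g \<in> I}"

definition saturation :: "'a::comm_ring_1 set \<Rightarrow> 'a set \<Rightarrow> 'a set"
  where "saturation I J = (\<Union>k. colon I (ideal_power J k))"

definition monomial_ideal :: "('n, 'k::comm_ring_1) mpoly set \<Rightarrow> bool"
  where "monomial_ideal I \<longleftrightarrow> (\<exists>A. I = ideal_gen (monom ` A))"

definition borel_type :: "('n::{finite,linorder}, 'k::comm_ring_1) mpoly set \<Rightarrow> bool"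
  where "borel_type I \<longleftrightarrow> monomial_ideal I \<and>
    (\<forall>j. saturation I (ideal_gen {var j}) = saturation I (ideal_gen (var ` {..j})))"

definition bracket_power :: "('n, 'k::comm_ring_1) mpoly set \<Rightarrow> nat \<Rightarrow> ('n, 'k) mpoly set"
  where "bracket_power I q = ideal_gen {u ^ q | u. u \<in> I \<and> u \<in> range monom}"


section \<open>Graded free resolutions of the residue field\<close>

text \<open>
  A record \<open>F\<close> describes a complex \<open>\<dots> \<rightarrow> F_2 \<rightarrow> F_1 \<rightarrow> F_0 \<rightarrow> K \<rightarrow> 0\<close> of graded free \<open>S\<close>-modules
  of finite rank: \<open>F_i\<close> has basis \<open>e_k\<close> for \<open>k < rank F i\<close>, with \<open>e_k\<close> in degree
  \<open>shift F i k\<close>; the map \<open>F_{i+1} \<rightarrow> F_i\<close> has matrix \<open>diff F i\<close> (row \<open>k\<close>, column \<open>l\<close>);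
  and \<open>F_0 \<rightarrow> K\<close> sends \<open>e_k\<close> to \<open>aug F k\<close>. A vector is a function on \<open>nat\<close> which
  vanishes outside the index range.
\<close>

record (overloaded) ('n, 'k) free_complex =
  rank :: "nat \<Rightarrow> nat"
  shift :: "nat \<Rightarrow> nat \<Rightarrow> int"
  diff :: "nat \<Rightarrow> nat \<Rightarrow> nat \<Rightarrow> ('n, 'k) mpoly"
  aug :: "nat \<Rightarrow> 'k"

definition free_mod :: "nat \<Rightarrow> (nat \<Rightarrow> 'm::zero) set"
  where "free_mod r = {v. \<forall>k\<ge>r. v k = 0}"

text \<open>
  The differential \<open>F_{i+1} \<otimes> M \<rightarrow> F_i \<otimes> M\<close>, where \<open>F_i \<otimes> M\<close> is identified with the direct sum
  of \<open>rank F i\<close> copies of \<open>M\<close>, and \<open>scale\<close> is the action of \<open>S\<close> on \<open>M\<close>. Taking \<open>scale\<close> to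
  be the multiplication of \<open>S\<close> gives the differential of \<open>F\<close> itself.
\<close>

definition boundary ::
    "(('n, 'k) mpoly \<Rightarrow> 'm \<Rightarrow> 'm) \<Rightarrow> ('n, 'k::zero) free_complex \<Rightarrow> nat \<Rightarrow>
      (nat \<Rightarrow> 'm::comm_monoid_add) \<Rightarrow> nat \<Rightarrow> 'm"
  where "boundary scale F i v =
    (\<lambda>k. if k < rank F i then \<Sum>l<rank F (Suc i). scale (diff F i k l) (v l) else 0)"

text \<open>
  The action of \<open>S\<close> on \<open>K\<close> is through the constant coefficient \<open>lookup p 0\<close>, and \<open>K\<close> is
  concentrated in degree \<open>0\<close>.
\<close>

definition augmentation ::
    "('n, 'k::comm_ring_1) free_complex \<Rightarrow> (nat \<Rightarrow> ('n, 'k) mpoly) \<Rightarrow> 'k"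
  where "augmentation F v = (\<Sum>k<rank F 0. Poly_Mapping.lookup (v k) 0 * aug F k)"

definition resolves_residue_field :: "('n::finite, 'k::field) free_complex \<Rightarrow> bool"
  where "resolves_residue_field F \<longleftrightarrow>
    (\<forall>i. \<forall>k<rank F i. \<forall>l<rank F (Suc i).
       diff F i k l \<in> homogeneous (shift F (Suc i) l - shift F i k)) \<and>
    (\<forall>k<rank F 0. aug F k \<noteq> 0 \<longrightarrow> shift F 0 k = 0) \<and>
    augmentation F ` free_mod (rank F 0) = UNIV \<and>
    {v \<in> free_mod (rank F 0). augmentation F v = 0} = boundary (*) F 0 ` free_mod (rank F 1) \<and>
    (\<forall>i. {v \<in> free_mod (rank F (Suc i)). boundary (*) F i v = (\<lambda>_. 0)} =
       boundary (*) F (Suc i) ` free_mod (rank F (Suc (Suc i))))"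


section \<open>Graded Tor, Betti numbers and regularity\<close>

text \<open>
  A graded \<open>S\<close>-module is given by the action \<open>scale\<close> and the family \<open>M\<close> of its homogeneous
  components. The component of degree \<open>j\<close> of \<open>F_i \<otimes> M\<close>:
\<close>

definition chains ::
    "(int \<Rightarrow> 'm::zero set) \<Rightarrow> ('n, 'k::zero) free_complex \<Rightarrow> nat \<Rightarrow> int \<Rightarrow> (nat \<Rightarrow> 'm) set"
  where "chains M F i j = {v \<in> free_mod (rank F i). \<forall>k<rank F i. v k \<in> M (j - shift F i k)}"

fun cycles ::
    "(('n, 'k) mpoly \<Rightarrow> 'm \<Rightarrow> 'm) \<Rightarrow> (int \<Rightarrow> 'm::ab_group_add set) \<Rightarrow>
      ('n, 'k::zero) free_complex \<Rightarrow> nat \<Rightarrow> int \<Rightarrow> (nat \<Rightarrow> 'm) set" where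
  "cycles scale M F 0 j = chains M F 0 j"
| "cycles scale M F (Suc i) j = {v \<in> chains M F (Suc i) j. boundary scale F i v = (\<lambda>_. 0)}"

definition boundaries ::
    "(('n, 'k) mpoly \<Rightarrow> 'm \<Rightarrow> 'm) \<Rightarrow> (int \<Rightarrow> 'm::ab_group_add set) \<Rightarrow>
      ('n, 'k::zero) free_complex \<Rightarrow> nat \<Rightarrow> int \<Rightarrow> (nat \<Rightarrow> 'm) set"
  where "boundaries scale M F i j = boundary scale F i ` chains M F (Suc i) j"

definition vec_dim ::
    "(('n, 'k::field) mpoly \<Rightarrow> 'm::ab_group_add \<Rightarrow> 'm) \<Rightarrow> (nat \<Rightarrow> 'm) set \<Rightarrow> nat"
  where "vec_dim scale = vector_space.dim (\<lambda>(c::'k) v k. scale (const c) (v k))"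

text \<open>
  \<open>Tor_i(K, M)_j\<close> is the quotient of \<open>cycles\<close> by \<open>boundaries\<close>, for any choice of a graded free
  resolution of \<open>K\<close>. Its dimension is computed as a difference, which is meaningful when
  the components of \<open>M\<close> have finite dimension over \<open>K\<close>, as they do for finitely generated \<open>M\<close>.
\<close>

definition betti ::
    "(('n::finite, 'k::field) mpoly \<Rightarrow> 'm \<Rightarrow> 'm) \<Rightarrow> (int \<Rightarrow> 'm::ab_group_add set) \<Rightarrow>
      nat \<Rightarrow> int \<Rightarrow> nat"
  where "betti scale M i j =
    (let F = (SOME F. resolves_residue_field F)
     in vec_dim scale (cycles scale M F i j) - vec_dim scale (boundaries scale M F i j))"

definition regularity ::
    "(('n::finite, 'k::field) mpoly \<Rightarrow> 'm \<Rightarrow> 'm) \<Rightarrow> (int \<Rightarrow> 'm::ab_group_add set) \<Rightarrow> int"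
  where "regularity scale M = Max {j - int i | i j. betti scale M i j \<noteq> 0}"

definition ideal_reg :: "('n::finite, 'k::field) mpoly set \<Rightarrow> int"
  where "ideal_reg I = regularity (*) (\<lambda>d. I \<inter> homogeneous d)"

end

(*
  By comparison of resolutions, Tor(K, I) may be computed from the Koszul complex, which splits
  into multidegrees; its part of multidegree a is the simplicial chain complex of the upper Koszul
  complex Delta_a(I) of all squarefree T <= a with x^(a-T) in I. One has Delta_{qa}(I^[q]) =
  Delta_a(I), because x^(qa-T) lies in I^[q] iff x^(a-T) lies in I. Hence a nonzero Betti number
  of I in homological degree i and multidegree a yields one of I^[q] in degree i and multidegree
  qa, and q|a| - i >= q(|a| - i). The maxima defining the regularities are attained because
  Delta_a(I) is a cone unless x^a divides the lcm of the generators.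
*)

theory Submission
  imports Defs
begin

text \<open>The obstacle is the definition of \<open>betti\<close>: it refers to a resolution picked
  by \<open>SOME\<close> and to a truncated difference of dimensions. Neither is evaluated. Only the
  question which Betti numbers are nonzero matters, so two facts are enough: finite dimension makes
  the difference vanish exactly when cycles equal boundaries, and this equality does not depend on
  the resolution. The Koszul complex serves both for computing and as the witness that a resolution
  exists, without which \<open>SOME\<close> would say nothing. Multidegrees are available only
  there, as a general \<open>free_complex\<close> carries just integer shifts, so the splitting has
  to come after the comparison. The final estimate loses exactly (q - 1)i: bracket powers multiply
  multidegrees by q and leave homological degrees alone.\<close>

abbreviation coeff :: "('n, 'k::zero) mpoly \<Rightarrow> ('n \<Rightarrow>\<^sub>0 nat) \<Rightarrow> 'k"
  where "coeff \<equiv> Poly_Mapping.lookup"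

abbreviation supp :: "('n \<Rightarrow>\<^sub>0 nat) \<Rightarrow> 'n set"
  where "supp \<equiv> Poly_Mapping.keys"

lemma module_mult: "module ((*) :: 'a::comm_ring_1 \<Rightarrow> 'a \<Rightarrow> 'a)"
  by unfold_locales (simp_all add: algebra_simps)

abbreviation is_ideal :: "'a::comm_ring_1 set \<Rightarrow> bool"
  where "is_ideal \<equiv> module.subspace (*)"

lemma is_ideal_iff:
  "is_ideal I \<longleftrightarrow> 0 \<in> I \<and> (\<forall>x\<in>I. \<forall>y\<in>I. x + y \<in> I) \<and> (\<forall>c. \<forall>x\<in>I. c * x \<in> I)"
  using module.subspace_def[OF module_mult] .

section \<open>Homogeneous components\<close>

lemma deg_0 [simp]: "deg 0 = 0"
  by (simp add: deg_def)

lemma deg_add: "deg (a + b) = deg a + deg b"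
  by (simp add: deg_def lookup_add sum.distrib)

lemma homogeneous_coeff: "p \<in> homogeneous d \<Longrightarrow> coeff p a \<noteq> 0 \<Longrightarrow> int (deg a) = d"
  by (auto simp: homogeneous_def in_keys_iff)

lemma homogeneousI: "(\<And>a. coeff p a \<noteq> 0 \<Longrightarrow> int (deg a) = d) \<Longrightarrow> p \<in> homogeneous d"
  by (auto simp: homogeneous_def in_keys_iff)

lemma homogeneous_0 [simp]: "0 \<in> homogeneous d"
  by (auto intro: homogeneousI)

lemma homogeneous_add:
  "p \<in> homogeneous d \<Longrightarrow> q \<in> homogeneous d \<Longrightarrow> p + q \<in> homogeneous d"
  for p q :: "('n::finite, 'k::monoid_add) mpoly"
  by (rule homogeneousI) (metis add.left_neutral homogeneous_coeff lookup_add)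

lemma homogeneous_diff:
  "p \<in> homogeneous d \<Longrightarrow> q \<in> homogeneous d \<Longrightarrow> p - q \<in> homogeneous d"
  for p q :: "('n::finite, 'k::ab_group_add) mpoly"
  by (rule homogeneousI) (metis diff_zero homogeneous_coeff lookup_minus)

lemma homogeneous_mult:
  "p \<in> homogeneous d \<Longrightarrow> q \<in> homogeneous e \<Longrightarrow> p * q \<in> homogeneous (d + e)"
  for p q :: "('n::finite, 'k::comm_ring_1) mpoly"
  unfolding homogeneous_def using keys_mult[of p q] by (fastforce simp: deg_add)

text \<open>Exactness in \<open>resolves_residue_field\<close> is about arbitrary vectors, while
  chain maps must respect degrees; these components turn a preimage into a homogeneous one.\<close>

definition hcomp :: "int \<Rightarrow> ('n::finite, 'k::comm_monoid_add) mpoly \<Rightarrow> ('n, 'k) mpoly"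
  where "hcomp d p = (\<Sum>a | a \<in> Poly_Mapping.keys p \<and> int (deg a) = d. Poly_Mapping.single a (coeff p a))"

lemma coeff_hcomp: "coeff (hcomp d p) a = (if int (deg a) = d then coeff p a else 0)"
proof -
  let ?A = "{a. a \<in> Poly_Mapping.keys p \<and> int (deg a) = d}"
  have fin: "finite ?A" by (rule finite_subset[of _ "Poly_Mapping.keys p"]) auto
  have "coeff (hcomp d p) a = (\<Sum>b\<in>?A. if b = a then coeff p a else 0)"
    unfolding hcomp_def lookup_sum by (rule sum.cong) (auto simp: lookup_single when_def)
  also have "\<dots> = (if int (deg a) = d then coeff p a else 0)"
    using fin by (simp add: in_keys_iff)
  finally show ?thesis .
qed

lemma hcomp_homogeneous: "hcomp d p \<in> homogeneous d"
  by (rule homogeneousI) (simp add: coeff_hcomp split: if_splits)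

lemma hcomp_id: "p \<in> homogeneous d \<Longrightarrow> hcomp d p = p"
  by (rule poly_mapping_eqI) (auto simp: coeff_hcomp dest: homogeneous_coeff)

lemma hcomp_sum: "hcomp d (\<Sum>x\<in>X. f x) = (\<Sum>x\<in>X. hcomp d (f x))"
proof (rule poly_mapping_eqI)
  show "coeff (hcomp d (\<Sum>x\<in>X. f x)) a = coeff (\<Sum>x\<in>X. hcomp d (f x)) a" for a
    by (simp add: coeff_hcomp lookup_sum)
qed

text \<open>Multiplication by \<open>f\<close> shifts degrees by \<open>d\<close>, so the part of
  \<open>p\<close> outside degree \<open>e - d\<close> (called \<open>r\<close> in the proof)
  contributes nothing in degree \<open>e\<close>.\<close>

lemma hcomp_mult:
  fixes f p :: "('n::finite, 'k::comm_ring_1) mpoly"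
  assumes f: "f \<in> homogeneous d"
  shows "hcomp e (f * p) = f * hcomp (e - d) p"
proof (rule poly_mapping_eqI)
  fix a
  define r where "r = p - hcomp (e - d) p"
  have dec: "coeff (f * p) a = coeff (f * hcomp (e - d) p) a + coeff (f * r) a"
    by (simp add: r_def algebra_simps lookup_add lookup_minus)
  show "coeff (hcomp e (f * p)) a = coeff (f * hcomp (e - d) p) a"
  proof (cases "int (deg a) = e")
    case True
    have "a \<notin> Poly_Mapping.keys (f * r)"
    proof
      assume "a \<in> Poly_Mapping.keys (f * r)"
      then obtain b c where "a = b + c" "b \<in> Poly_Mapping.keys f" "c \<in> Poly_Mapping.keys r"
        using keys_mult[of f r] by blast
      with f True show False
        by (auto simp: homogeneous_def r_def in_keys_iff lookup_minus coeff_hcomp deg_add split: if_splits)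
    qed
    then show ?thesis using dec True by (simp add: coeff_hcomp in_keys_iff)
  next
    case False
    have "f * hcomp (e - d) p \<in> homogeneous e"
      using homogeneous_mult[OF f hcomp_homogeneous[of "e - d" p]] by simp
    with False show ?thesis by (auto simp: coeff_hcomp dest: homogeneous_coeff)
  qed
qed

text \<open>Exponents are natural numbers, so 0 splits only as 0 + 0. This is what makes
  \<open>augmentation\<close> S-linear.\<close>

lemma const_coeff_mult:
  fixes p q :: "('n, 'k::comm_ring_1) mpoly"
  shows "coeff (p * q) 0 = coeff p 0 * coeff q 0"
proof -
  have ker: "coeff (p * q) 0 = 0" if "coeff p 0 = 0" for p q :: "('n, 'k) mpoly"
  proof (rule ccontr)
    assume "coeff (p * q) 0 \<noteq> 0"
    then obtain b c :: "'n \<Rightarrow>\<^sub>0 nat" where bc: "b + c = 0" "b \<in> Poly_Mapping.keys p"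
      using keys_mult[of p q] in_keys_iff[of 0 "p * q"] by fastforce
    have "b = 0"
    proof (rule poly_mapping_eqI)
      show "Poly_Mapping.lookup b i = Poly_Mapping.lookup 0 i" for i
        using arg_cong[OF bc(1), of "\<lambda>a. Poly_Mapping.lookup a i"] by (simp add: lookup_add)
    qed
    with bc(2) that show False by (simp add: in_keys_iff)
  qed
  let ?c = "Poly_Mapping.single 0 (coeff p 0) :: ('n, 'k) mpoly"
  let ?d = "Poly_Mapping.single 0 (coeff q 0) :: ('n, 'k) mpoly"
  have "p * q = ?c * ?d + (p - ?c) * q + (q - ?d) * ?c" by (simp add: algebra_simps)
  then have "coeff (p * q) 0 = coeff (?c * ?d) 0"
    by (simp add: lookup_add ker lookup_minus)
  then show ?thesis by (simp add: mult_single)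
qed

section \<open>Graded maps of free modules\<close>

text \<open>These are the S-linear maps of degree 0 between two free modules, given by the images
  \<open>A l\<close> of the basis vectors. Such a function accepts any sequence, ignores the entries
  from \<open>rank F i\<close> on and lands in the free module of \<open>G\<close>, so equations
  between these maps need no side conditions.\<close>

definition graded_map ::
    "('n::finite, 'k::field) free_complex \<Rightarrow> nat \<Rightarrow> ('n, 'k) free_complex \<Rightarrow> nat \<Rightarrow>
      ((nat \<Rightarrow> ('n, 'k) mpoly) \<Rightarrow> nat \<Rightarrow> ('n, 'k) mpoly) \<Rightarrow> bool"
  where "graded_map F i G m f \<longleftrightarrow>
    (\<exists>A. (\<forall>l<rank F i. A l \<in> chains homogeneous G m (shift F i l)) \<and>
      f = (\<lambda>v k. \<Sum>l<rank F i. v l * A l k))"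

lemma graded_mapI:
  assumes "\<And>l. l < rank F i \<Longrightarrow> A l \<in> chains homogeneous G m (shift F i l)"
    and "\<And>v k. f v k = (\<Sum>l<rank F i. v l * A l k)"
  shows "graded_map F i G m f"
  unfolding graded_map_def using assms by (intro exI[of _ A]) (auto simp: fun_eq_iff)

lemma graded_map_add: "graded_map F i G m f \<Longrightarrow> f (u + v) = f u + f v"
  by (auto simp: graded_map_def fun_eq_iff algebra_simps sum.distrib)

lemma graded_map_diff: "graded_map F i G m f \<Longrightarrow> f (u - v) = f u - f v"
  by (auto simp: graded_map_def fun_eq_iff algebra_simps sum_subtractf)

lemma graded_map_0: "graded_map F i G m f \<Longrightarrow> f 0 = 0"
  by (auto simp: graded_map_def fun_eq_iff)

text \<open>An ideal absorbs the matrix entries and degrees add up, so a graded map induces one on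
  the complexes tensored with \<open>I\<close>.\<close>

lemma graded_map_chains:
  fixes F G :: "('n::finite, 'k::field) free_complex"
  assumes f: "graded_map F i G m f" and I: "is_ideal I"
    and v: "v \<in> chains (\<lambda>d. I \<inter> homogeneous d) F i j"
  shows "f v \<in> chains (\<lambda>d. I \<inter> homogeneous d) G m j"
proof -
  obtain A where A: "\<And>l. l < rank F i \<Longrightarrow> A l \<in> chains homogeneous G m (shift F i l)"
    and f_eq: "f = (\<lambda>v k. \<Sum>l<rank F i. v l * A l k)"
    using f unfolding graded_map_def by auto
  have "v l * A l k \<in> I \<inter> homogeneous (j - shift G m k)" if "l < rank F i" "k < rank G m" for k l
  proof -
    have "v l \<in> I" "v l \<in> homogeneous (j - shift F i l)"
      "A l k \<in> homogeneous (shift F i l - shift G m k)"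
      using A[OF that(1)] v that by (auto simp: chains_def)
    moreover from this have "v l * A l k \<in> homogeneous (j - shift G m k)"
      using homogeneous_mult[of "v l" "j - shift F i l" "A l k" "shift F i l - shift G m k"] by simp
    ultimately show ?thesis using I by (simp add: is_ideal_iff mult.commute[of "v l"])
  qed
  then have "(\<Sum>l<r. v l * A l k) \<in> I \<inter> homogeneous (j - shift G m k)"
    if "k < rank G m" "r \<le> rank F i" for k r
    using that(2) by (induction r) (use I that(1) in \<open>auto simp: is_ideal_iff intro!: homogeneous_add\<close>)
  moreover have "f v k = 0" if "k \<ge> rank G m" for k
    using A that by (auto simp: f_eq chains_def free_mod_def)
  ultimately show ?thesis by (auto simp: chains_def free_mod_def f_eq)
qed

lemma is_ideal_UNIV: "is_ideal UNIV"
  by (simp add: is_ideal_iff)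

lemma graded_map_chains_UNIV:
  assumes "graded_map F i G m f" and "v \<in> chains homogeneous F i j"
  shows "f v \<in> chains homogeneous G m j"
  using graded_map_chains[OF assms(1) is_ideal_UNIV] assms(2) by simp

lemma graded_map_free_mod: "graded_map F i G m f \<Longrightarrow> f v \<in> free_mod (rank G m)"
  by (auto simp: graded_map_def chains_def free_mod_def)

lemma graded_map_sum:
  fixes r :: nat
  assumes "graded_map F i G m f"
  shows "f (\<lambda>k. \<Sum>l<r. c l * B l k) = (\<lambda>k. \<Sum>l<r. c l * f (B l) k)"
proof -
  obtain A where f_eq: "f = (\<lambda>v k. \<Sum>l<rank F i. v l * A l k)"
    using assms unfolding graded_map_def by auto
  show ?thesis
    by (simp add: f_eq fun_eq_iff sum_distrib_left sum_distrib_right mult.assoc sum.swap[of _ "{..<r}"])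
qed

lemma graded_map_comp:
  assumes f: "graded_map F i G m f" and g: "graded_map G m H r g"
  shows "graded_map F i H r (\<lambda>v. g (f v))"
proof -
  obtain A where A: "\<And>l. l < rank F i \<Longrightarrow> A l \<in> chains homogeneous G m (shift F i l)"
    and f_eq: "f = (\<lambda>v k. \<Sum>l<rank F i. v l * A l k)"
    using f unfolding graded_map_def by auto
  show ?thesis
    by (rule graded_mapI[where A = "\<lambda>l. g (A l)"])
      (use A graded_map_chains_UNIV[OF g] graded_map_sum[OF g] f_eq in auto)
qed

lemma graded_map_minus:
  assumes f: "graded_map F i G m f" and g: "graded_map F i G m g"
  shows "graded_map F i G m (\<lambda>v. f v - g v)"
proof -
  obtain A where A: "\<And>l. l < rank F i \<Longrightarrow> A l \<in> chains homogeneous G m (shift F i l)"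
    and f_eq: "f = (\<lambda>v k. \<Sum>l<rank F i. v l * A l k)"
    using f unfolding graded_map_def by auto
  obtain B where B: "\<And>l. l < rank F i \<Longrightarrow> B l \<in> chains homogeneous G m (shift F i l)"
    and g_eq: "g = (\<lambda>v k. \<Sum>l<rank F i. v l * B l k)"
    using g unfolding graded_map_def by auto
  show ?thesis
  proof (rule graded_mapI[where A = "\<lambda>l. A l - B l"])
    show "A l - B l \<in> chains homogeneous G m (shift F i l)" if "l < rank F i" for l
      using A[OF that] B[OF that] by (auto simp: chains_def free_mod_def homogeneous_diff)
  qed (simp add: f_eq g_eq algebra_simps sum_subtractf)
qed

definition unit_vec :: "nat \<Rightarrow> nat \<Rightarrow> 'a::zero_neq_one"
  where "unit_vec l = (\<lambda>k. if k = l then 1 else 0)"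

lemma one_homogeneous: "(1 :: ('n::finite, 'k::field) mpoly) \<in> homogeneous 0"
  by (rule homogeneousI) (auto simp: lookup_one when_def split: if_splits)

lemma unit_vec_chains:
  fixes F :: "('n::finite, 'k::field) free_complex"
  shows "l < rank F i \<Longrightarrow> (unit_vec l :: nat \<Rightarrow> ('n, 'k) mpoly) \<in> chains homogeneous F i (shift F i l)"
  by (auto simp: chains_def free_mod_def unit_vec_def one_homogeneous)

lemma graded_map_unit_vec:
  assumes "graded_map F i G m f"
  shows "f v k = (\<Sum>l<rank F i. v l * f (unit_vec l) k)"
proof -
  obtain A where f_eq: "f = (\<lambda>v k. \<Sum>l<rank F i. v l * A l k)"
    using assms unfolding graded_map_def by auto
  have "f (unit_vec l) k = A l k" if "l < rank F i" for l
  proof -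
    have "f (unit_vec l) k = (\<Sum>l'<rank F i. if l' = l then A l k else 0)"
      unfolding f_eq by (rule sum.cong) (auto simp: unit_vec_def)
    then show ?thesis using that by simp
  qed
  then show ?thesis by (simp add: f_eq)
qed

text \<open>The identity of a free module in the form that \<open>graded_map\<close> requires;
  \<open>id\<close> does not qualify, as it keeps entries beyond the rank.\<close>

definition proj :: "nat \<Rightarrow> (nat \<Rightarrow> 'a) \<Rightarrow> nat \<Rightarrow> 'a::zero"
  where "proj r v = (\<lambda>k. if k < r then v k else 0)"

lemma proj_free_mod: "v \<in> free_mod r \<Longrightarrow> proj r v = v"
  by (auto simp: proj_def free_mod_def fun_eq_iff)

lemma graded_map_proj: "graded_map F i F i (proj (rank F i))"
proof (rule graded_mapI[where A = unit_vec])
  fix v :: "nat \<Rightarrow> ('a, 'b) mpoly" and k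
  have "(\<Sum>l<rank F i. v l * unit_vec l k) = (\<Sum>l<rank F i. if l = k then v k else 0)"
    by (rule sum.cong) (auto simp: unit_vec_def)
  then show "proj (rank F i) v k = (\<Sum>l<rank F i. v l * unit_vec l k)"
    by (simp add: proj_def)
qed (rule unit_vec_chains)

section \<open>Lifting graded maps through exact complexes\<close>

definition graded_complex :: "('n::finite, 'k::zero) free_complex \<Rightarrow> bool"
  where "graded_complex F \<longleftrightarrow> (\<forall>i. \<forall>k<rank F i. \<forall>l<rank F (Suc i).
       diff F i k l \<in> homogeneous (shift F (Suc i) l - shift F i k))"

lemma resolves_graded: "resolves_residue_field F \<Longrightarrow> graded_complex F"
  by (auto simp: resolves_residue_field_def graded_complex_def)

lemma graded_map_boundary:
  assumes "graded_complex F"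
  shows "graded_map F (Suc i) F i (boundary (*) F i)"
  by (rule graded_mapI[where A = "\<lambda>l k. if k < rank F i then diff F i k l else 0"])
    (use assms in \<open>auto simp: chains_def free_mod_def boundary_def graded_complex_def mult.commute\<close>)

text \<open>The differential preserves degree, so dropping from any preimage \<open>x\<close> the
  components outside degree \<open>j\<close> does not change an image that has degree
  \<open>j\<close>.\<close>

lemma homogeneous_preimage:
  fixes G :: "('n::finite, 'k::field) free_complex"
  assumes G: "graded_complex G" and u: "u \<in> chains homogeneous G m j"
    and im: "u \<in> boundary (*) G m ` free_mod (rank G (Suc m))"
  shows "\<exists>w \<in> chains homogeneous G (Suc m) j. boundary (*) G m w = u"
proof -
  obtain x where x: "x \<in> free_mod (rank G (Suc m))" "u = boundary (*) G m x" using im by auto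
  define w where "w = (\<lambda>l. if l < rank G (Suc m) then hcomp (j - shift G (Suc m) l) (x l) else 0)"
  have "boundary (*) G m w k = u k" for k
  proof (cases "k < rank G m")
    case True
    have "boundary (*) G m w k = (\<Sum>l<rank G (Suc m). hcomp (j - shift G m k) (diff G m k l * x l))"
    proof -
      have "diff G m k l * w l = hcomp (j - shift G m k) (diff G m k l * x l)" if "l < rank G (Suc m)" for l
      proof -
        have "diff G m k l \<in> homogeneous (shift G (Suc m) l - shift G m k)"
          using G True that by (auto simp: graded_complex_def)
        from hcomp_mult[OF this, of "j - shift G m k" "x l"] that show ?thesis by (simp add: w_def)
      qed
      then show ?thesis using True by (simp add: boundary_def)
    qed
    also have "\<dots> = hcomp (j - shift G m k) (u k)"
      using True by (simp add: x(2) boundary_def hcomp_sum)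
    also have "\<dots> = u k" using u True by (auto simp: chains_def hcomp_id)
    finally show ?thesis .
  qed (simp add: x(2) boundary_def)
  moreover have "w \<in> chains homogeneous G (Suc m) j"
    by (auto simp: w_def chains_def free_mod_def hcomp_homogeneous)
  ultimately show ?thesis by blast
qed

text \<open>Projectivity of free modules in graded form: homogeneous preimages are chosen for the
  images of basis vectors and extended linearly.\<close>

lemma graded_map_lift:
  fixes F G :: "('n::finite, 'k::field) free_complex"
  assumes G: "graded_complex G" and f: "graded_map F i G m f"
    and im: "\<And>v. f v \<in> boundary (*) G m ` free_mod (rank G (Suc m))"
  shows "\<exists>g. graded_map F i G (Suc m) g \<and> (\<forall>v. boundary (*) G m (g v) = f v)"
proof -
  have "\<exists>w \<in> chains homogeneous G (Suc m) (shift F i l). boundary (*) G m w = f (unit_vec l)"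
    if "l < rank F i" for l
    using homogeneous_preimage[OF G graded_map_chains_UNIV[OF f unit_vec_chains[OF that]] im] .
  then obtain w where w: "\<And>l. l < rank F i \<Longrightarrow> w l \<in> chains homogeneous G (Suc m) (shift F i l)"
    "\<And>l. l < rank F i \<Longrightarrow> boundary (*) G m (w l) = f (unit_vec l)"
    by metis
  define g where "g = (\<lambda>v k. \<Sum>l<rank F i. v l * w l k)"
  have "boundary (*) G m (g v) = f v" for v
    unfolding g_def graded_map_sum[OF graded_map_boundary[OF G]]
    by (simp add: fun_eq_iff w(2) graded_map_unit_vec[OF f, of v])
  moreover have "graded_map F i G (Suc m) g"
    by (rule graded_mapI[OF w(1)]) (simp_all add: g_def)
  ultimately show ?thesis by blast
qed

lemma augmentation_sum:
  "augmentation G (\<lambda>k. \<Sum>l<r. c l * B l k) = (\<Sum>l<r. coeff (c l) 0 * augmentation G (B l))"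
  by (simp add: augmentation_def lookup_sum const_coeff_mult sum_distrib_left sum_distrib_right
      mult.assoc sum.swap[of _ "{..<r}"])

lemma augmentation_diff: "augmentation G (u - v) = augmentation G u - augmentation G v"
  by (simp add: augmentation_def lookup_minus algebra_simps sum_subtractf)

text \<open>Starts the comparison map. K sits in degree 0, so a basis vector with nonzero
  augmentation has degree 0 and needs a lift of degree 0.\<close>

lemma graded_map_lift_augmentation:
  fixes F G :: "('n::finite, 'k::field) free_complex"
  assumes F: "resolves_residue_field F" and G: "resolves_residue_field G"
  shows "\<exists>g. graded_map F 0 G 0 g \<and> (\<forall>v. augmentation G (g v) = augmentation F v)"
proof -
  have "\<exists>w \<in> chains homogeneous G 0 (shift F 0 l). augmentation G w = aug F l"
    if l: "l < rank F 0" for l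
  proof (cases "aug F l = 0")
    case True
    then show ?thesis
      by (intro bexI[of _ 0]) (auto simp: chains_def free_mod_def augmentation_def)
  next
    case False
    then have s: "shift F 0 l = 0" using F l by (auto simp: resolves_residue_field_def)
    have "aug F l \<in> augmentation G ` free_mod (rank G 0)"
      using G by (simp add: resolves_residue_field_def)
    then obtain x where x: "aug F l = augmentation G x" by blast
    define w where "w = (\<lambda>k. if k < rank G 0 then hcomp (- shift G 0 k) (x k) else 0)"
    have "w \<in> chains homogeneous G 0 (shift F 0 l)"
      by (auto simp: w_def chains_def free_mod_def hcomp_homogeneous s)
    \<comment> \<open>Truncation alters constant coefficients only at positions of nonzero shift,
      and there \<open>aug G k\<close> is 0.\<close>
    moreover have "augmentation G w = augmentation G x"
      unfolding augmentation_def using G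
      by (intro sum.cong) (auto simp: w_def coeff_hcomp resolves_residue_field_def)
    ultimately show ?thesis using x by auto
  qed
  then obtain w where w: "\<And>l. l < rank F 0 \<Longrightarrow> w l \<in> chains homogeneous G 0 (shift F 0 l)"
    "\<And>l. l < rank F 0 \<Longrightarrow> augmentation G (w l) = aug F l"
    by metis
  define g where "g = (\<lambda>v k. \<Sum>l<rank F 0. v l * w l k)"
  have "augmentation G (g v) = augmentation F v" for v
    unfolding g_def augmentation_sum by (simp add: w(2) augmentation_def[of F])
  moreover have "graded_map F 0 G 0 g"
    by (rule graded_mapI[OF w(1)]) (simp_all add: g_def)
  ultimately show ?thesis by blast
qed

section \<open>Comparison of resolutions\<close>

lemma resolves_exact_aug:
  "resolves_residue_field G \<Longrightarrow> v \<in> free_mod (rank G 0) \<Longrightarrow> augmentation G v = 0 \<Longrightarrow>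
    v \<in> boundary (*) G 0 ` free_mod (rank G (Suc 0))"
  unfolding resolves_residue_field_def by auto

lemma resolves_exact:
  "resolves_residue_field G \<Longrightarrow> v \<in> free_mod (rank G (Suc i)) \<Longrightarrow> boundary (*) G i v = 0 \<Longrightarrow>
    v \<in> boundary (*) G (Suc i) ` free_mod (rank G (Suc (Suc i)))"
  unfolding resolves_residue_field_def zero_fun_def by blast

lemma boundary_proj: "boundary (*) G i (proj (rank G (Suc i)) v) = boundary (*) G i v"
  by (auto simp: boundary_def proj_def fun_eq_iff intro!: sum.cong)

lemma proj_in_free_mod: "proj r v \<in> free_mod r"
  by (simp add: proj_def free_mod_def)

lemma aug_boundary:
  assumes "resolves_residue_field F"
  shows "augmentation F (boundary (*) F 0 v) = 0"
proof -
  have "boundary (*) F 0 (proj (rank F (Suc 0)) v) \<in> boundary (*) F 0 ` free_mod (rank F 1)"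
    using proj_in_free_mod by auto
  then show ?thesis using assms unfolding boundary_proj resolves_residue_field_def by blast
qed

lemma boundary_boundary:
  assumes "resolves_residue_field F"
  shows "boundary (*) F i (boundary (*) F (Suc i) v) = 0"
proof -
  have "boundary (*) F (Suc i) (proj (rank F (Suc (Suc i))) v) \<in>
      boundary (*) F (Suc i) ` free_mod (rank F (Suc (Suc i)))"
    using proj_in_free_mod by blast
  then show ?thesis using assms
    unfolding boundary_proj resolves_residue_field_def zero_fun_def by blast
qed

text \<open>The identity of K is lifted one homological degree at a time. As \<open>F\<close> is
  free, each step only needs the composite to land in the image of the next differential of
  \<open>G\<close>.\<close>

lemma comparison_map:
  fixes F G :: "('n::finite, 'k::field) free_complex"
  assumes F: "resolves_residue_field F" and G: "resolves_residue_field G"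
  obtains \<phi> where "\<And>i. graded_map F i G i (\<phi> i)"
    and "\<And>v. augmentation G (\<phi> 0 v) = augmentation F v"
    and "\<And>i v. boundary (*) G i (\<phi> (Suc i) v) = \<phi> i (boundary (*) F i v)"
proof -
  \<comment> \<open>Besides gradedness the invariant carries what the next lift needs: the composite
    with the differential of \<open>F\<close> is killed by the preceding differential of
    \<open>G\<close>. In degree 0, compatibility with the augmentations has the same effect.\<close>
  let ?P = "\<lambda>i x. graded_map F i G i x \<and>
    (case i of 0 \<Rightarrow> \<forall>v. augmentation G (x v) = augmentation F v
      | Suc m \<Rightarrow> \<forall>v. boundary (*) G m (x (boundary (*) F i v)) = 0)"
  let ?Q = "\<lambda>i x y. \<forall>v. boundary (*) G i (y v) = x (boundary (*) F i v)"
  have "\<exists>\<phi>. \<forall>i. ?P i (\<phi> i) \<and> ?Q i (\<phi> i) (\<phi> (Suc i))"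
  proof (rule dependent_nat_choice)
    show "\<exists>x. ?P 0 x" using graded_map_lift_augmentation[OF F G] by simp
  next
    fix x i assume P: "?P i x"
    then have x: "graded_map F i G i x" by simp
    have hom: "graded_map F (Suc i) G i (\<lambda>v. x (boundary (*) F i v))"
      using graded_map_comp[OF graded_map_boundary[OF resolves_graded[OF F]] x] .
    have "x (boundary (*) F i v) \<in> boundary (*) G i ` free_mod (rank G (Suc i))" for v
    proof (cases i)
      case 0
      then show ?thesis
        using P resolves_exact_aug[OF G] graded_map_free_mod[OF x] aug_boundary[OF F] by simp
    next
      case (Suc m)
      then show ?thesis
        using P resolves_exact[OF G] graded_map_free_mod[OF x] by simp
    qed
    from graded_map_lift[OF resolves_graded[OF G] hom this] obtain y
      where "graded_map F (Suc i) G (Suc i) y"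
        and "\<And>v. boundary (*) G i (y v) = x (boundary (*) F i v)" by auto
    moreover have "x (boundary (*) F i (boundary (*) F (Suc i) v)) = 0" for v
      by (simp add: boundary_boundary[OF F] graded_map_0[OF x])
    ultimately show "\<exists>y. ?P (Suc i) y \<and> ?Q i x y" by auto
  qed
  then obtain \<phi> where \<phi>: "\<And>i. ?P i (\<phi> i)" "\<And>i. ?Q i (\<phi> i) (\<phi> (Suc i))" by auto
  show thesis
    using that[of \<phi>] \<phi> \<phi>(1)[of 0] by auto
qed

text \<open>The part of \<open>\<chi> (Suc i)\<close> not yet accounted for by \<open>h i\<close> is
  a cycle, hence a boundary by exactness; lifting it gives \<open>h (Suc i)\<close>. The last
  conjunct of \<open>?P\<close> is this cycle property.\<close>

lemma null_homotopy:
  fixes F :: "('n::finite, 'k::field) free_complex"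
  assumes F: "resolves_residue_field F" and \<chi>: "\<And>i. graded_map F i F i (\<chi> i)"
    and aug: "\<And>v. augmentation F (\<chi> 0 v) = 0"
    and comm: "\<And>i v. boundary (*) F i (\<chi> (Suc i) v) = \<chi> i (boundary (*) F i v)"
  obtains h where "\<And>i. graded_map F i F (Suc i) (h i)"
    and "\<And>v. boundary (*) F 0 (h 0 v) = \<chi> 0 v"
    and "\<And>i v. boundary (*) F (Suc i) (h (Suc i) v) = \<chi> (Suc i) v - h i (boundary (*) F i v)"
proof -
  note gF = resolves_graded[OF F]
  let ?P = "\<lambda>i x. graded_map F i F (Suc i) x \<and> (i = 0 \<longrightarrow> (\<forall>v. boundary (*) F 0 (x v) = \<chi> 0 v)) \<and>
    (\<forall>v. boundary (*) F i (\<chi> (Suc i) v - x (boundary (*) F i v)) = 0)"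
  let ?Q = "\<lambda>i x y. \<forall>v. boundary (*) F (Suc i) (y v) = \<chi> (Suc i) v - x (boundary (*) F i v)"
  have "\<exists>h. \<forall>i. ?P i (h i) \<and> ?Q i (h i) (h (Suc i))"
  proof (rule dependent_nat_choice)
    have "\<chi> 0 v \<in> boundary (*) F 0 ` free_mod (rank F (Suc 0))" for v
      using resolves_exact_aug[OF F graded_map_free_mod[OF \<chi>] aug] .
    from graded_map_lift[OF gF \<chi> this] obtain x where
      "graded_map F 0 F (Suc 0) x" "\<And>v. boundary (*) F 0 (x v) = \<chi> 0 v" by auto
    then show "\<exists>x. ?P 0 x"
      by (auto simp: graded_map_diff[OF graded_map_boundary[OF gF]] comm)
  next
    fix x i assume P: "?P i x"
    then have x: "graded_map F i F (Suc i) x" by simp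
    have hom: "graded_map F (Suc i) F (Suc i) (\<lambda>v. \<chi> (Suc i) v - x (boundary (*) F i v))"
      using graded_map_minus[OF \<chi> graded_map_comp[OF graded_map_boundary[OF gF] x]] .
    have "\<chi> (Suc i) v - x (boundary (*) F i v) \<in>
        boundary (*) F (Suc i) ` free_mod (rank F (Suc (Suc i)))" for v
      using resolves_exact[OF F graded_map_free_mod[OF hom]] P by simp
    from graded_map_lift[OF gF hom this] obtain y where
      "graded_map F (Suc i) F (Suc (Suc i)) y"
      "\<And>v. boundary (*) F (Suc i) (y v) = \<chi> (Suc i) v - x (boundary (*) F i v)" by auto
    then show "\<exists>y. ?P (Suc i) y \<and> ?Q i x y"
      by (auto simp: graded_map_diff[OF graded_map_boundary[OF gF]] comm
          boundary_boundary[OF F] graded_map_0[OF x])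
  qed
  then obtain h where "\<forall>i. ?P i (h i) \<and> ?Q i (h i) (h (Suc i))" ..
  then have h: "\<And>i. ?P i (h i)" "\<And>i. ?Q i (h i) (h (Suc i))" by blast+
  show thesis
    by (rule that[of h]) (use h in auto)
qed

lemma chains_ideal_subset: "chains (\<lambda>d. I \<inter> homogeneous d) F i j \<subseteq> free_mod (rank F i)"
  by (auto simp: chains_def)

lemma cycles_subset_chains: "cycles s M F i j \<subseteq> chains M F i j"
  by (cases i) auto

lemma boundaries_subset_cycles:
  fixes F :: "('n::finite, 'k::field) free_complex"
  assumes F: "resolves_residue_field F" and I: "is_ideal I"
  shows "boundaries (*) (\<lambda>d. I \<inter> homogeneous d) F i j \<subseteq> cycles (*) (\<lambda>d. I \<inter> homogeneous d) F i j"
proof -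
  have "boundary (*) F i v \<in> chains (\<lambda>d. I \<inter> homogeneous d) F i j"
    if "v \<in> chains (\<lambda>d. I \<inter> homogeneous d) F (Suc i) j" for v
    using graded_map_chains[OF graded_map_boundary[OF resolves_graded[OF F]] I that] .
  then show ?thesis
    unfolding boundaries_def using boundary_boundary[OF F] by (cases i) (auto simp: zero_fun_def)
qed

text \<open>Going from \<open>F\<close> to \<open>G\<close> and back is homotopic to the identity,
  and chain maps and homotopies also act with coefficients in \<open>I\<close>. Since only vanishing
  is transferred, this one round trip suffices.\<close>

theorem Tor_vanishing_independent:
  fixes F G :: "('n::finite, 'k::field) free_complex"
  assumes F: "resolves_residue_field F" and G: "resolves_residue_field G" and I: "is_ideal I"
    and eq: "cycles (*) (\<lambda>d. I \<inter> homogeneous d) G i j = boundaries (*) (\<lambda>d. I \<inter> homogeneous d) G i j"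
  shows "cycles (*) (\<lambda>d. I \<inter> homogeneous d) F i j = boundaries (*) (\<lambda>d. I \<inter> homogeneous d) F i j"
proof (rule antisym[OF subsetI boundaries_subset_cycles[OF F I]])
  let ?M = "\<lambda>d. I \<inter> homogeneous d"
  obtain \<phi> where \<phi>: "\<And>i. graded_map F i G i (\<phi> i)"
    "\<And>v. augmentation G (\<phi> 0 v) = augmentation F v"
    "\<And>i v. boundary (*) G i (\<phi> (Suc i) v) = \<phi> i (boundary (*) F i v)"
    using comparison_map[OF F G] by blast
  obtain \<psi> where \<psi>: "\<And>i. graded_map G i F i (\<psi> i)"
    "\<And>v. augmentation F (\<psi> 0 v) = augmentation G v"
    "\<And>i v. boundary (*) F i (\<psi> (Suc i) v) = \<psi> i (boundary (*) G i v)"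
    using comparison_map[OF G F] by blast
  note gF = resolves_graded[OF F]
  note bF = graded_map_boundary[OF gF]
  \<comment> \<open>\<open>proj\<close> stands for the identity, so \<open>\<chi>\<close> measures
    how far the round trip is from it.\<close>
  define \<chi> where "\<chi> = (\<lambda>i v. proj (rank F i) v - \<psi> i (\<phi> i v))"
  have \<chi>: "graded_map F i F i (\<chi> i)" for i
    unfolding \<chi>_def by (intro graded_map_minus graded_map_proj graded_map_comp[OF \<phi>(1) \<psi>(1)])
  have "augmentation F (proj (rank F 0) v) = augmentation F v" for v
    by (simp add: augmentation_def proj_def)
  then have aug: "augmentation F (\<chi> 0 v) = 0" for v
    by (simp add: \<chi>_def augmentation_diff \<phi> \<psi>)
  have comm: "boundary (*) F i (\<chi> (Suc i) v) = \<chi> i (boundary (*) F i v)" for i v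
    by (simp add: \<chi>_def graded_map_diff[OF bF] \<phi> \<psi> boundary_proj
        proj_free_mod[OF graded_map_free_mod[OF bF]])
  obtain h where h: "\<And>i. graded_map F i F (Suc i) (h i)"
    "\<And>v. boundary (*) F 0 (h 0 v) = \<chi> 0 v"
    "\<And>i v. boundary (*) F (Suc i) (h (Suc i) v) = \<chi> (Suc i) v - h i (boundary (*) F i v)"
    using null_homotopy[OF F \<chi> aug comm] by blast
  fix v assume v: "v \<in> cycles (*) ?M F i j"
  then have vc: "v \<in> chains ?M F i j" using cycles_subset_chains by blast
  have hv: "h i v \<in> chains ?M F (Suc i) j" using graded_map_chains[OF h(1) I vc] .
  \<comment> \<open>On a cycle, the term of the homotopy formula that involves the differential of
    \<open>v\<close> drops out.\<close>
  have "boundary (*) F i (h i v) = \<chi> i v"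
  proof (cases i)
    case (Suc m)
    then have "boundary (*) F m v = 0" using v by (simp add: zero_fun_def)
    then show ?thesis using Suc h(3)[of m v] graded_map_0[OF h(1)] by simp
  qed (simp add: h(2))
  then have v_eq: "v = boundary (*) F i (h i v) + \<psi> i (\<phi> i v)"
    using proj_free_mod[OF subsetD[OF chains_ideal_subset vc]] by (simp add: \<chi>_def)
  have "\<phi> i v \<in> cycles (*) ?M G i j"
  proof (cases i)
    case (Suc m)
    then have "boundary (*) F m v = 0" using v by (simp add: zero_fun_def)
    then have "boundary (*) G m (\<phi> i v) = 0" using Suc \<phi>(3)[of m v] graded_map_0[OF \<phi>(1)] by simp
    then show ?thesis using Suc graded_map_chains[OF \<phi>(1) I vc] by (simp add: zero_fun_def)
  qed (use graded_map_chains[OF \<phi>(1) I vc] in simp)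
  then obtain w where w: "w \<in> chains ?M G (Suc i) j" "\<phi> i v = boundary (*) G i w"
    using eq by (auto simp: boundaries_def)
  have "v = boundary (*) F i (h i v + \<psi> (Suc i) w)"
    using v_eq by (simp add: graded_map_add[OF bF] w(2) \<psi>(3))
  moreover have "h i v + \<psi> (Suc i) w \<in> chains ?M F (Suc i) j"
    using hv graded_map_chains[OF \<psi>(1) I w(1)] I
    by (auto simp: chains_def free_mod_def is_ideal_iff homogeneous_add)
  ultimately show "v \<in> boundaries (*) ?M F i j" by (auto simp: boundaries_def)
qed

section \<open>Non-vanishing Betti numbers\<close>

text \<open>A basis \<open>B\<close> of \<open>U\<close> extends to a basis \<open>C\<close> of
  \<open>V\<close>, and for finite sets \<open>card C\<close> <= \<open>card B\<close> forces
  \<open>B = C\<close>. The finite spanning set \<open>W\<close> rules out infinite bases, whose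
  \<open>card\<close> would be 0.\<close>

lemma (in vector_space) dim_diff_eq_0_iff:
  assumes "U \<subseteq> V" "subspace U" "V \<subseteq> span W" "finite W"
  shows "dim V - dim U = 0 \<longleftrightarrow> U = V"
proof
  obtain B where B: "B \<subseteq> U" "independent B" "U \<subseteq> span B"
    using maximal_independent_subset[of U] by blast
  obtain C where C: "B \<subseteq> C" "C \<subseteq> V" "independent C" "V \<subseteq> span C"
    using maximal_independent_subset_extend[of B V] B assms(1) by blast
  have fin: "finite C" using independent_span_bound[OF assms(4) C(3)] C(2) assms(3) by blast
  assume "dim V - dim U = 0"
  then have "card C \<le> card B"
    using basis_card_eq_dim[OF B(1,3,2)] basis_card_eq_dim[OF C(2,4,3)] by simp
  then have "B = C" using C(1) fin by (simp add: card_seteq)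
  then show "U = V" using C(4) span_minimal[OF B(1) assms(2)] assms(1) by blast
qed simp

lemma finite_deg: "finite {a :: 'n::finite \<Rightarrow>\<^sub>0 nat. int (deg a) = d}"
proof (rule finite_imageD)
  have "Poly_Mapping.lookup a i \<le> deg a" for a :: "'n \<Rightarrow>\<^sub>0 nat" and i
    unfolding deg_def by (rule member_le_sum) auto
  note le = this
  have "Poly_Mapping.lookup ` {a :: 'n \<Rightarrow>\<^sub>0 nat. int (deg a) = d} \<subseteq> 
      {f. \<forall>i. (i \<in> UNIV \<longrightarrow> f i \<in> {..nat d}) \<and> (i \<notin> UNIV \<longrightarrow> f i = 0)}"
  proof
    fix f assume "f \<in> Poly_Mapping.lookup ` {a :: 'n \<Rightarrow>\<^sub>0 nat. int (deg a) = d}"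
    then obtain a :: "'n \<Rightarrow>\<^sub>0 nat" where a: "f = Poly_Mapping.lookup a" "deg a = nat d" by force
    show "f \<in> {f. \<forall>i. (i \<in> UNIV \<longrightarrow> f i \<in> {..nat d}) \<and> (i \<notin> UNIV \<longrightarrow> f i = 0)}"
      using le[of a] unfolding a by simp
  qed
  then show "finite (Poly_Mapping.lookup ` {a :: 'n \<Rightarrow>\<^sub>0 nat. int (deg a) = d})"
    using finite_set_of_finite_funs[OF finite finite_atMost] by (rule finite_subset)
qed (rule inj_onI, rule poly_mapping_eqI, simp)

lemma vector_space_vec:
  "vector_space (\<lambda>(c::'k::field) (v :: nat \<Rightarrow> ('n, 'k) mpoly) k. const c * v k)"
  by unfold_locales
    (auto simp: fun_eq_iff const_def algebra_simps single_add mult_single single_one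
      simp flip: mult.assoc)

lemma poly_eq_sum_monom:
  fixes p :: "('n, 'k::field) mpoly"
  shows "p = (\<Sum>a\<in>Poly_Mapping.keys p. const (coeff p a) * monom a)"
proof (rule poly_mapping_eqI)
  fix b
  have "coeff (\<Sum>a\<in>Poly_Mapping.keys p. const (coeff p a) * monom a) b
      = (\<Sum>a\<in>Poly_Mapping.keys p. if a = b then coeff p b else 0)"
    unfolding lookup_sum
    by (rule sum.cong) (auto simp: const_def monom_def mult_single lookup_single when_def)
  then show "coeff p b = coeff (\<Sum>a\<in>Poly_Mapping.keys p. const (coeff p a) * monom a) b"
    by (simp add: in_keys_iff)
qed

text \<open>Supplies the finite dimension that gives the difference in \<open>betti\<close> its
  meaning. \<open>W\<close> takes all monomials of the right degree in each coordinate, whether they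
  lie in \<open>I\<close> or not.\<close>

lemma chains_finite_span:
  fixes F :: "('n::finite, 'k::field) free_complex" and I :: "('n, 'k) mpoly set"
  obtains W where "finite W" and
    "chains (\<lambda>d. I \<inter> homogeneous d) F i j \<subseteq> module.span (\<lambda>c v k. const c * v k) W"
proof -
  interpret V: vector_space "\<lambda>(c::'k) (v :: nat \<Rightarrow> ('n, 'k) mpoly) k. const c * v k"
    by (rule vector_space_vec)
  define e :: "nat \<Rightarrow> ('n \<Rightarrow>\<^sub>0 nat) \<Rightarrow> nat \<Rightarrow> ('n, 'k) mpoly"
    where "e = (\<lambda>k a k'. if k' = k then monom a else 0)"
  define W where "W = (\<Union>k<rank F i. e k ` {a. int (deg a) = j - shift F i k})"
  show thesis
  proof
    show "finite W" unfolding W_def by (auto intro: finite_deg)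
    show "chains (\<lambda>d. I \<inter> homogeneous d) F i j \<subseteq> V.span W"
    proof
      fix v assume v: "v \<in> chains (\<lambda>d. I \<inter> homogeneous d) F i j"
      let ?s = "\<Sum>k<rank F i. \<Sum>a\<in>Poly_Mapping.keys (v k). (\<lambda>k'. const (coeff (v k) a) * e k a k')"
      have sum_app: "(\<Sum>x\<in>A. f x) k' = (\<Sum>x\<in>A. f x k')"
        for A :: "'x set" and f :: "'x \<Rightarrow> nat \<Rightarrow> ('n, 'k) mpoly" and k'
        by (induction A rule: infinite_finite_induct) auto
      have "v k' = ?s k'" for k'
      proof -
        have "?s k' = (\<Sum>k<rank F i. if k = k' then v k' else 0)"
          unfolding sum_app
        proof (rule sum.cong)
          show "(\<Sum>a\<in>Poly_Mapping.keys (v k). const (coeff (v k) a) * e k a k') =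
              (if k = k' then v k' else 0)" for k
            using poly_eq_sum_monom[of "v k"] by (auto simp: e_def)
        qed simp
        then show ?thesis using v by (auto simp: chains_def free_mod_def)
      qed
      then have v_eq: "v = ?s" ..
      have "e k a \<in> W" if "k < rank F i" "a \<in> Poly_Mapping.keys (v k)" for k a
        using v that by (fastforce simp: W_def chains_def homogeneous_def)
      then show "v \<in> V.span W"
        by (subst v_eq) (intro V.span_sum V.span_scale V.span_base, auto)
    qed
  qed
qed

lemma subspace_boundaries:
  fixes F :: "('n::finite, 'k::field) free_complex" and I :: "('n, 'k) mpoly set"
  assumes I: "is_ideal I"
  shows "module.subspace (\<lambda>c v k. const c * v k)
    (boundaries (*) (\<lambda>d. I \<inter> homogeneous d) F i j)"
proof -
  let ?C = "chains (\<lambda>d. I \<inter> homogeneous d) F (Suc i) j"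
  interpret V: vector_space "\<lambda>(c::'k) (v :: nat \<Rightarrow> ('n, 'k) mpoly) k. const c * v k"
    by (rule vector_space_vec)
  have hom: "const c * p \<in> homogeneous d" if "p \<in> homogeneous d" for c :: 'k and p :: "('n, 'k) mpoly" and d
  proof -
    have "(const c :: ('n, 'k) mpoly) \<in> homogeneous 0"
      by (auto simp: const_def homogeneous_def)
    from homogeneous_mult[OF this that] show ?thesis by simp
  qed
  have add: "boundary (*) F i u + boundary (*) F i v = boundary (*) F i (u + v)" for u v
    by (auto simp: boundary_def fun_eq_iff algebra_simps sum.distrib)
  have scale: "(\<lambda>k. const c * boundary (*) F i u k) = boundary (*) F i (\<lambda>k. const c * u k)" for c u
    by (auto simp: boundary_def fun_eq_iff sum_distrib_left mult.left_commute)
  have zero: "0 = boundary (*) F i 0" by (auto simp: boundary_def fun_eq_iff)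
  have "0 \<in> ?C" "\<And>u v. u \<in> ?C \<Longrightarrow> v \<in> ?C \<Longrightarrow> u + v \<in> ?C"
    "\<And>c u. u \<in> ?C \<Longrightarrow> (\<lambda>k. const c * u k) \<in> ?C"
    using I by (auto simp: chains_def free_mod_def is_ideal_iff homogeneous_add hom)
  then show ?thesis
    unfolding V.subspace_def boundaries_def using add scale zero
    by (auto 0 3 simp: image_iff intro!: bexI)
qed

text \<open>The given \<open>F\<close> ensures that \<open>SOME\<close> picks a resolution;
  vanishing of Tor is then carried between that choice and \<open>F\<close>.\<close>

lemma betti_nonzero_iff:
  fixes I :: "('n::finite, 'k::field) mpoly set" and F :: "('n, 'k) free_complex"
  assumes F: "resolves_residue_field F" and I: "is_ideal I"
  shows "betti (*) (\<lambda>d. I \<inter> homogeneous d) i j \<noteq> 0 \<longleftrightarrow>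
    cycles (*) (\<lambda>d. I \<inter> homogeneous d) F i j \<noteq> boundaries (*) (\<lambda>d. I \<inter> homogeneous d) F i j"
proof -
  interpret V: vector_space "\<lambda>(c::'k) (v :: nat \<Rightarrow> ('n, 'k) mpoly) k. const c * v k"
    by (rule vector_space_vec)
  let ?M = "\<lambda>d. I \<inter> homogeneous d"
  define G :: "('n, 'k) free_complex" where "G = (SOME F. resolves_residue_field F)"
  have G: "resolves_residue_field G" unfolding G_def using F by (rule someI)
  obtain W where W: "finite W" "chains ?M G i j \<subseteq> V.span W"
    using chains_finite_span by blast
  have "betti (*) ?M i j = 0 \<longleftrightarrow> boundaries (*) ?M G i j = cycles (*) ?M G i j"
    unfolding betti_def Let_def G_def[symmetric] vec_dim_def
    by (rule V.dim_diff_eq_0_iff[OF boundaries_subset_cycles[OF G I] subspace_boundaries[OF I] _ W(1)])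
      (use W(2) cycles_subset_chains in blast)
  then show ?thesis
    using Tor_vanishing_independent[OF F G I] Tor_vanishing_independent[OF G F I] by metis
qed

section \<open>Signed simplicial chains\<close>

definition ksign :: "'n::linorder \<Rightarrow> 'n set \<Rightarrow> 'k::field"
  where "ksign x S = (- 1) ^ card {y \<in> S. y < x}"

lemma ksign_insert:
  fixes S :: "'n::{finite,linorder} set"
  assumes "y \<notin> S"
  shows "ksign x (insert y S) = (if y < x then - ksign x S else ksign x S)"
proof -
  have "{z \<in> insert y S. z < x} =
      (if y < x then insert y {z \<in> S. z < x} else {z \<in> S. z < x})" by auto
  then show ?thesis using assms by (auto simp: ksign_def)
qed

lemma ksign_square: "ksign x S * ksign x S = 1"
  by (simp add: ksign_def flip: power_add mult_2)

text \<open>The simplicial boundary on coefficients: \<open>g T\<close> is the coefficient of the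
  face \<open>T\<close>, and the faces with \<open>S\<close> as a facet arise by adding one vertex
  to \<open>S\<close>.\<close>

definition kdiff :: "('n::{finite,linorder} set \<Rightarrow> 'k::field) \<Rightarrow> 'n set \<Rightarrow> 'k"
  where "kdiff g S = (\<Sum>x\<in>-S. ksign x S * g (insert x S))"

lemma kdiff_0 [simp]: "kdiff 0 = 0"
  by (simp add: kdiff_def fun_eq_iff)

text \<open>Two vertices can be added to \<open>S\<close> in either order, and the two contributions
  have opposite signs.\<close>

lemma kdiff_kdiff:
  fixes g :: "'n::{finite,linorder} set \<Rightarrow> 'k::field"
  shows "kdiff (kdiff g) = 0"
proof
  fix S :: "'n set"
  let ?t = "\<lambda>(x, y). ksign x S * ksign y S * g (insert y (insert x S))"
  let ?L = "{(x, y). x \<notin> S \<and> y \<notin> S \<and> x < y}" and ?G = "{(x, y). x \<notin> S \<and> y \<notin> S \<and> y < x}"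
  have "kdiff (kdiff g) S =
      (\<Sum>x\<in>-S. \<Sum>y\<in>-S - {x}. ksign x S * (ksign y (insert x S) * g (insert y (insert x S))))"
    by (auto simp: kdiff_def sum_distrib_left intro!: sum.cong)
  \<comment> \<open>The sign of \<open>y\<close> flips when a smaller \<open>x\<close> has been
    inserted before it, so exactly the pairs with \<open>x < y\<close> get a minus.\<close>
  also have "\<dots> = (\<Sum>x\<in>-S. \<Sum>y\<in>-S - {x}. if x < y then - ?t (x, y) else ?t (x, y))"
    by (intro sum.cong refl) (auto simp: ksign_insert mult.assoc)
  also have "\<dots> = (\<Sum>(x, y)\<in>(SIGMA x:-S. -S - {x}). if x < y then - ?t (x, y) else ?t (x, y))"
    by (subst sum.Sigma) auto
  also have "(SIGMA x:-S. -S - {x}) = ?L \<union> ?G" by auto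
  also have "(\<Sum>(x, y)\<in>?L \<union> ?G. if x < y then - ?t (x, y) else ?t (x, y)) =
      (\<Sum>(x, y)\<in>?L. if x < y then - ?t (x, y) else ?t (x, y)) +
      (\<Sum>(x, y)\<in>?G. if x < y then - ?t (x, y) else ?t (x, y))"
    by (rule sum.union_disjoint) auto
  also have "(\<Sum>(x, y)\<in>?L. if x < y then - ?t (x, y) else ?t (x, y)) = - (\<Sum>p\<in>?L. ?t p)"
    unfolding sum_negf[symmetric] by (rule sum.cong) auto
  also have "(\<Sum>(x, y)\<in>?G. if x < y then - ?t (x, y) else ?t (x, y)) = (\<Sum>p\<in>?G. ?t p)"
    by (rule sum.cong) auto
  also have "(\<Sum>p\<in>?G. ?t p) = (\<Sum>p\<in>?L. ?t p)"
    by (rule sum.reindex_bij_witness[of _ prod.swap prod.swap])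
      (auto simp: insert_commute mult.commute)
  finally show "kdiff (kdiff g) S = 0 S" by simp
qed

definition supported :: "('n set \<Rightarrow> 'k::zero) \<Rightarrow> 'n set set \<Rightarrow> nat \<Rightarrow> bool"
  where "supported g \<Delta> i \<longleftrightarrow> (\<forall>T. g T \<noteq> 0 \<longrightarrow> T \<in> \<Delta> \<and> card T = i)"

text \<open>Vanishing of reduced simplicial homology over the field. Faces are indexed by
  cardinality, so \<open>i\<close> stands for dimension i - 1, and the empty face has index
  0.\<close>

definition exact_at :: "'k::field itself \<Rightarrow> 'n::{finite,linorder} set set \<Rightarrow> nat \<Rightarrow> bool"
  where "exact_at _ \<Delta> i \<longleftrightarrow> (\<forall>g :: 'n set \<Rightarrow> 'k. supported g \<Delta> i \<longrightarrow> kdiff g = 0 \<longrightarrow>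
    (\<exists>h. supported h \<Delta> (Suc i) \<and> kdiff h = g))"

lemma supported_0 [simp]: "supported 0 \<Delta> i"
  by (simp add: supported_def)

lemma kdiff_supported_0: "supported g \<Delta> 0 \<Longrightarrow> kdiff g = 0"
  for g :: "'n::{finite,linorder} set \<Rightarrow> 'k::field"
proof
  fix S assume g: "supported g \<Delta> 0"
  have "g (insert x S) = 0" for x
  proof (rule ccontr)
    assume "g (insert x S) \<noteq> 0"
    then have "card (insert x S) = 0" using g by (auto simp: supported_def)
    then show False by simp
  qed
  then show "kdiff g S = 0 S" by (simp add: kdiff_def)
qed

text \<open>Joining the faces of a cycle with the apex \<open>k\<close> gives a chain that it
  bounds. Faces already containing \<open>k\<close> are lost in the join; the cycle condition
  recovers their coefficients.\<close>

lemma exact_at_cone: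
  fixes \<Delta> :: "'n::{finite,linorder} set set"
  assumes cone: "\<And>T. T \<in> \<Delta> \<Longrightarrow> insert k T \<in> \<Delta>"
  shows "exact_at (TYPE('k::field)) \<Delta> i"
  unfolding exact_at_def
proof (intro allI impI)
  fix g :: "'n set \<Rightarrow> 'k"
  assume g: "supported g \<Delta> i" and 0: "kdiff g = 0"
  define h where "h T = (if k \<in> T then ksign k (T - {k}) * g (T - {k}) else 0)" for T
  have "kdiff h S = g S" for S
  proof (cases "k \<in> S")
    case False
    have "kdiff h S = (\<Sum>x\<in>-S. if x = k then g S else 0)"
      unfolding kdiff_def
      by (rule sum.cong) (use False in \<open>auto simp: h_def ksign_square simp flip: mult.assoc\<close>)
    then show ?thesis using False by simp
  next
    case True
    define S' where "S' = S - {k}"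
    have S: "S = insert k S'" "k \<notin> S'" using True by (auto simp: S'_def)
    \<comment> \<open>The cycle condition at \<open>S - {k}\<close> expresses the coefficient of
      \<open>S\<close> through those of faces avoiding \<open>k\<close>.\<close>
    have "0 = kdiff g S'" using 0 by (simp add: fun_eq_iff)
    also have "\<dots> = ksign k S' * g S + (\<Sum>x\<in>-S. ksign x S' * g (insert x S'))"
    proof -
      have "- S' = insert k (- S)" using S by auto
      then have "kdiff g S' = (\<Sum>x\<in>insert k (- S). ksign x S' * g (insert x S'))"
        by (simp only: kdiff_def)
      also have "\<dots> = ksign k S' * g (insert k S') + (\<Sum>x\<in>-S. ksign x S' * g (insert x S'))"
        by (rule sum.insert) (use True in auto)
      finally show ?thesis by (simp only: S(1)[symmetric])
    qed
    finally have "ksign k S' * g S + (\<Sum>x\<in>-S. ksign x S' * g (insert x S')) = 0" ..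
    from minus_unique[OF this]
    have eq: "(\<Sum>x\<in>-S. ksign x S' * g (insert x S')) = - (ksign k S' * g S)" by (rule sym)
    have "kdiff h S = (\<Sum>x\<in>-S. - ksign k S' * (ksign x S' * g (insert x S')))"
      unfolding kdiff_def
    proof (rule sum.cong)
      fix x assume "x \<in> - S"
      then have x: "x \<notin> S'" "x \<noteq> k" "insert x S - {k} = insert x S'" using S by auto
      \<comment> \<open>Of the two signs exactly one flips, namely that of the larger of
        \<open>k\<close> and \<open>x\<close>.\<close>
      have "ksign x S * ksign k (insert x S') = - ksign k S' * (ksign x S' :: 'k)"
      proof (cases "k < x")
        case True
        then have "\<not> x < k" by simp
        with True show ?thesis
          unfolding S(1) by (simp add: ksign_insert[OF S(2)] ksign_insert[OF x(1)])
      next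
        case False
        then have "x < k" using x(2) by simp
        with False show ?thesis
          unfolding S(1) by (simp add: ksign_insert[OF S(2)] ksign_insert[OF x(1)])
      qed
      moreover have "h (insert x S) = ksign k (insert x S') * g (insert x S')"
        using x True by (simp add: h_def)
      ultimately show "ksign x S * h (insert x S) = - ksign k S' * (ksign x S' * g (insert x S'))"
        by (metis mult.assoc)
    qed simp
    also have "\<dots> = - ksign k S' * - (ksign k S' * g S)"
      unfolding sum_distrib_left[symmetric] eq ..
    also have "\<dots> = g S" by (simp add: ksign_square flip: mult.assoc)
    finally show ?thesis .
  qed
  moreover have "supported h \<Delta> (Suc i)"
    unfolding supported_def
  proof (intro allI impI)
    fix T assume "h T \<noteq> 0"
    then have T: "k \<in> T" "g (T - {k}) \<noteq> 0" by (auto simp: h_def split: if_splits)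
    then have "T - {k} \<in> \<Delta>" "card (T - {k}) = i" using g by (auto simp: supported_def)
    moreover have "insert k (T - {k}) = T" using T(1) by blast
    moreover have "card T = Suc (card (T - {k}))" by (rule card.remove) (use T(1) in simp_all)
    ultimately show "T \<in> \<Delta> \<and> card T = Suc i" using cone[of "T - {k}"] by metis
  qed
  ultimately show "\<exists>h. supported h \<Delta> (Suc i) \<and> kdiff h = g" by blast
qed

section \<open>The Koszul complex\<close>

lemma boundary_free_mod: "boundary s F i v \<in> free_mod (rank F i)"
  by (simp add: boundary_def free_mod_def)

lemma zero_free_mod: "0 \<in> free_mod r"
  by (simp add: free_mod_def)

text \<open>Subtraction of exponents truncates at 0, so \<open>a - s\<close> is the right exponent
  only under divisibility; hence the case distinction.\<close>

lemma coeff_single_mult: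
  fixes p :: "('n, 'k::field) mpoly"
  shows "coeff (Poly_Mapping.single s c * p) a = (if \<exists>b. a = s + b then c * coeff p (a - s) else 0)"
proof -
  have "Poly_Mapping.single s c * p
      = (\<Sum>b\<in>Poly_Mapping.keys p. Poly_Mapping.single s c * (const (coeff p b) * monom b))"
    by (subst poly_eq_sum_monom) (simp add: sum_distrib_left)
  also have "\<dots> = (\<Sum>b\<in>Poly_Mapping.keys p. Poly_Mapping.single (s + b) (c * coeff p b))"
    by (simp add: const_def monom_def mult_single)
  finally have eq: "coeff (Poly_Mapping.single s c * p) a =
      (\<Sum>b\<in>Poly_Mapping.keys p. if s + b = a then c * coeff p b else 0)"
    by (simp add: lookup_sum lookup_single when_def)
  show ?thesis
  proof (cases "\<exists>b. a = s + b")
    case True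
    then obtain b where b: "a = s + b" ..
    have "coeff (Poly_Mapping.single s c * p) a =
        (\<Sum>b'\<in>Poly_Mapping.keys p. if b' = b then c * coeff p b else 0)"
      unfolding eq by (rule sum.cong) (auto simp: b)
    also have "\<dots> = c * coeff p b" by (simp add: in_keys_iff)
    finally show ?thesis by (simp add: b)
  next
    case False
    then have "s + b \<noteq> a" for b by auto
    then show ?thesis using False by (simp add: eq)
  qed
qed

definition ind :: "'n::finite set \<Rightarrow> 'n \<Rightarrow>\<^sub>0 nat"
  where "ind T = (\<Sum>x\<in>T. Poly_Mapping.single x 1)"

lemma lookup_ind: "Poly_Mapping.lookup (ind T) x = (if x \<in> T then 1 else 0)"
proof -
  have "Poly_Mapping.lookup (ind T) x = (\<Sum>y\<in>T. if y = x then 1 else 0)"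
    unfolding ind_def lookup_sum by (rule sum.cong) (auto simp: lookup_single when_def)
  then show ?thesis by simp
qed

lemma ind_add_diff: "T \<subseteq> supp a \<Longrightarrow> ind T + (a - ind T) = a"
  by (rule poly_mapping_eqI) (auto simp: lookup_add lookup_minus lookup_ind in_keys_iff subset_iff
      Suc_le_eq)

lemma ind_empty [simp]: "ind {} = 0"
  by (simp add: ind_def)

lemma deg_ind: "deg (ind T) = card T"
  by (simp add: deg_def lookup_ind sum.If_cases)

text \<open>A \<open>free_complex\<close> numbers its basis vectors, while the Koszul complex has
  one for each \<open>i\<close>-subset; any numbering will do.\<close>

definition subset_enum :: "nat \<Rightarrow> nat \<Rightarrow> 'n::finite set"
  where "subset_enum i = (SOME b. bij_betw b {..<card {T :: 'n set. card T = i}} {T. card T = i})"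

lemma bij_subset_enum:
  "bij_betw (subset_enum i) {..<card {T :: 'n::finite set. card T = i}} {T :: 'n set. card T = i}"
  using someI_ex[OF ex_bij_betw_nat_finite[of "{T :: 'n set. card T = i}"]]
  by (simp add: subset_enum_def atLeast0LessThan)

text \<open>The basis vector of a set \<open>T\<close> is sent to the signed sum over x in
  \<open>T\<close> of x times the basis vector of \<open>T - {x}\<close>. An entry is written from
  its row, the smaller set, and at most one \<open>x\<close> contributes to its sum.\<close>

definition koszul :: "('n::{finite,linorder}, 'k::field) free_complex"
  where "koszul = \<lparr>
    rank = (\<lambda>i. card {T :: 'n set. card T = i}),
    shift = (\<lambda>i k. int i),
    diff = (\<lambda>i k l. \<Sum>x\<in>- subset_enum i k. if subset_enum (Suc i) l = insert x (subset_enum i k)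
      then Poly_Mapping.single (Poly_Mapping.single x 1) (ksign x (subset_enum i k)) else 0),
    aug = (\<lambda>_. 1)\<rparr>"

abbreviation krank :: "'n::{finite,linorder} itself \<Rightarrow> nat \<Rightarrow> nat"
  where "krank _ i \<equiv> card {T :: 'n set. card T = i}"

definition subset_index :: "nat \<Rightarrow> 'n::finite set \<Rightarrow> nat"
  where "subset_index i = the_inv_into {..<card {T :: 'n set. card T = i}} (subset_enum i)"

lemma subset_index:
  fixes T :: "'n::{finite,linorder} set"
  assumes "card T = i"
  shows "subset_index i T < krank TYPE('n) i" "subset_enum i (subset_index i T) = T"
proof -
  have "T \<in> subset_enum i ` {..<krank TYPE('n) i}"
    using bij_subset_enum[where 'n = 'n, of i] assms by (simp add: bij_betw_def)
  then show "subset_index i T < krank TYPE('n) i" "subset_enum i (subset_index i T) = T"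
    using the_inv_into_into[OF bij_betw_imp_inj_on[OF bij_subset_enum[where 'n = 'n, of i]], of T]
      f_the_inv_into_f[OF bij_betw_imp_inj_on[OF bij_subset_enum[where 'n = 'n, of i]], of T]
    by (auto simp: subset_index_def)
qed

lemma subset_enum:
  fixes i :: nat
  assumes "k < krank TYPE('n::{finite,linorder}) i"
  shows "card (subset_enum i k :: 'n set) = i" "subset_index i (subset_enum i k :: 'n set) = k"
proof -
  show "card (subset_enum i k :: 'n set) = i"
    using bij_betw_apply[OF bij_subset_enum[where 'n = 'n, of i]] assms by auto
  show "subset_index i (subset_enum i k :: 'n set) = k"
    unfolding subset_index_def
    by (rule the_inv_into_f_f[OF bij_betw_imp_inj_on[OF bij_subset_enum]]) (use assms in simp)
qed

lemma koszul_boundary: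
  fixes v :: "nat \<Rightarrow> ('n::{finite,linorder}, 'k::field) mpoly"
  assumes S: "card S = i"
  shows "boundary (*) koszul i v (subset_index i S) =
    (\<Sum>x\<in>-S. Poly_Mapping.single (Poly_Mapping.single x 1) (ksign x S) *
      v (subset_index (Suc i) (insert x S)))"
proof -
  let ?m = "\<lambda>x. Poly_Mapping.single (Poly_Mapping.single x 1) (ksign x S) :: ('n, 'k) mpoly"
  have "boundary (*) koszul i v (subset_index i S) = (\<Sum>l<krank TYPE('n) (Suc i).
      (\<Sum>x\<in>-S. if subset_enum (Suc i) l = insert x S then ?m x else 0) * v l)"
    using subset_index[OF S] by (simp add: boundary_def koszul_def cong: if_cong)
  also have "\<dots> = (\<Sum>x\<in>-S. \<Sum>l<krank TYPE('n) (Suc i).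
      if subset_enum (Suc i) l = insert x S then ?m x * v l else 0)"
    unfolding sum_distrib_right
    by (subst sum.swap) (intro sum.cong refl, simp)
  also have "\<dots> = (\<Sum>x\<in>-S. ?m x * v (subset_index (Suc i) (insert x S)))"
  proof (rule sum.cong[OF refl])
    fix x assume "x \<in> - S"
    then have c: "card (insert x S) = Suc i" using S by simp
    have "(\<Sum>l<krank TYPE('n) (Suc i). if subset_enum (Suc i) l = insert x S then ?m x * v l else 0)
      = (\<Sum>l<krank TYPE('n) (Suc i). if l = subset_index (Suc i) (insert x S) then ?m x * v l else 0)"
    proof (rule sum.cong[OF refl])
      fix l assume "l \<in> {..<krank TYPE('n) (Suc i)}"
      then have "subset_enum (Suc i) l = insert x S \<longleftrightarrow> l = subset_index (Suc i) (insert x S)"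
        using subset_index[OF c] subset_enum(2)[of l "Suc i", where 'n = 'n] by auto
      then show "(if subset_enum (Suc i) l = insert x S then ?m x * v l else 0) =
          (if l = subset_index (Suc i) (insert x S) then ?m x * v l else 0)" by simp
    qed
    then show "(\<Sum>l<krank TYPE('n) (Suc i). if subset_enum (Suc i) l = insert x S then ?m x * v l else 0)
      = ?m x * v (subset_index (Suc i) (insert x S))"
      using subset_index[OF c] by simp
  qed
  finally show ?thesis .
qed

section \<open>Multigraded strands of the Koszul complex\<close>

text \<open>
  The strand of multidegree \<open>a\<close>: the basis vector indexed by \<open>T\<close> has multidegree \<open>ind T\<close>, so its
  scalar coefficient in this strand is that of \<open>x^(a - ind T)\<close>.
\<close>

definition part :: "nat \<Rightarrow> ('n::{finite,linorder} \<Rightarrow>\<^sub>0 nat) \<Rightarrow> (nat \<Rightarrow> ('n, 'k::field) mpoly) \<Rightarrow> 'n set \<Rightarrow> 'k"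
  where "part i a v T =
    (if card T = i \<and> T \<subseteq> supp a then coeff (v (subset_index i T)) (a - ind T) else 0)"

lemma supported_part: "supported (part i a v) (Pow (supp a)) i"
  by (auto simp: supported_def part_def)

lemma part_0 [simp]: "part i a 0 = 0"
  by (auto simp: part_def fun_eq_iff)

text \<open>A variable x multiplies x^(a - T - x) to x^(a - T), so the differential preserves each
  strand, and on scalars only the signs remain.\<close>

lemma part_boundary: "part i a (boundary (*) koszul i v) = kdiff (part (Suc i) a v)"
proof
  fix S
  show "part i a (boundary (*) koszul i v) S = kdiff (part (Suc i) a v) S"
  proof (cases "card S = i \<and> S \<subseteq> supp a")
    case True
    have "coeff (Poly_Mapping.single (Poly_Mapping.single x 1) (ksign x S) *
        v (subset_index (Suc i) (insert x S))) (a - ind S) = ksign x S * part (Suc i) a v (insert x S)"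
      if x: "x \<notin> S" for x
    proof (cases "x \<in> supp a")
      case xa: True
      have "a - ind S = Poly_Mapping.single x 1 + (a - ind (insert x S))"
        by (rule poly_mapping_eqI)
          (use x xa in \<open>auto simp: lookup_add lookup_minus lookup_ind lookup_single when_def
            in_keys_iff\<close>)
      then show ?thesis using True x xa by (auto simp: coeff_single_mult part_def)
    next
      case False
      \<comment> \<open>Since \<open>x\<close> has exponent 0 in \<open>a\<close>, no multiple of
        this variable has exponent \<open>a - ind S\<close>, nor is \<open>insert x S\<close>
        contained in \<open>supp a\<close>: both sides are 0.\<close>
      have "a - ind S \<noteq> Poly_Mapping.single x 1 + b" for b
      proof
        assume "a - ind S = Poly_Mapping.single x 1 + b"
        from arg_cong[OF this, of "\<lambda>a. Poly_Mapping.lookup a x"] False show False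
          by (simp add: lookup_add lookup_minus in_keys_iff)
      qed
      then show ?thesis using False by (auto simp: coeff_single_mult part_def)
    qed
    then show ?thesis using True
      by (simp add: part_def[of i] koszul_boundary lookup_sum kdiff_def)
  next
    case False
    have "part (Suc i) a v (insert x S) = 0" if "x \<notin> S" for x
      using False that by (auto simp: part_def)
    then show ?thesis using False by (auto simp: part_def[of i] kdiff_def)
  qed
qed

text \<open>A term with exponent \<open>b\<close> at the basis vector of \<open>T\<close> belongs to
  multidegree \<open>ind T + b\<close>, so a vector is determined by its strands.\<close>

lemma coeff_eq_part:
  fixes v :: "nat \<Rightarrow> ('n::{finite,linorder}, 'k::field) mpoly"
  assumes "k < krank TYPE('n) i"
  shows "coeff (v k) b = part i (ind (subset_enum i k) + b) v (subset_enum i k)"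
proof -
  have "subset_enum i k \<subseteq> supp (ind (subset_enum i k) + b)"
    by (auto simp: in_keys_iff lookup_add lookup_ind)
  then show ?thesis using subset_enum[OF assms] by (simp add: part_def)
qed

lemma rank_koszul [simp]: "rank (koszul :: ('n::{finite,linorder}, 'k::field) free_complex) i = krank TYPE('n) i"
  by (simp add: koszul_def)

lemma part_eqI:
  fixes v w :: "nat \<Rightarrow> ('n::{finite,linorder}, 'k::field) mpoly"
  assumes "v \<in> free_mod (krank TYPE('n) i)" "w \<in> free_mod (krank TYPE('n) i)"
    and "\<And>a. part i a v = part i a w"
  shows "v = w"
proof
  show "v k = w k" for k
  proof (cases "k < krank TYPE('n) i")
    case True
    then show ?thesis by (intro poly_mapping_eqI) (simp add: coeff_eq_part assms(3))
  qed (use assms in \<open>simp add: free_mod_def\<close>)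
qed

lemma finite_parts: "finite {a. part i a v \<noteq> 0}"
  for v :: "nat \<Rightarrow> ('n::{finite,linorder}, 'k::field) mpoly"
proof (rule finite_subset)
  show "{a. part i a v \<noteq> 0} \<subseteq>
    (\<Union>k<krank TYPE('n) i. (\<lambda>b. ind (subset_enum i k) + b) ` Poly_Mapping.keys (v k))"
  proof
    fix a assume "a \<in> {a. part i a v \<noteq> 0}"
    then obtain T where T: "part i a v T \<noteq> 0" by (auto simp: fun_eq_iff)
    then have "card T = i" "T \<subseteq> supp a" "a - ind T \<in> Poly_Mapping.keys (v (subset_index i T))"
      by (auto simp: part_def in_keys_iff split: if_splits)
    then show "a \<in> (\<Union>k<krank TYPE('n) i. (\<lambda>b. ind (subset_enum i k) + b) ` Poly_Mapping.keys (v k))"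
      using subset_index[of T i] ind_add_diff[of T a]
      by (auto intro!: bexI[of _ "subset_index i T"] rev_image_eqI)
  qed
qed simp

text \<open>Puts the scalars of a simplicial chain back on the monomials of multidegree
  \<open>a\<close>, inverting \<open>part\<close> on that strand.\<close>

definition embed :: "nat \<Rightarrow> ('n::{finite,linorder} \<Rightarrow>\<^sub>0 nat) \<Rightarrow> ('n set \<Rightarrow> 'k::field) \<Rightarrow> nat \<Rightarrow> ('n, 'k) mpoly"
  where "embed i a g k =
    (if k < krank TYPE('n) i \<and> subset_enum i k \<subseteq> supp a
     then Poly_Mapping.single (a - ind (subset_enum i k)) (g (subset_enum i k)) else 0)"

lemma embed_free_mod:
  "embed i a (g :: 'n set \<Rightarrow> 'k::field) \<in> free_mod (krank TYPE('n::{finite,linorder}) i)"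
  by (simp add: free_mod_def embed_def)

lemma part_embed:
  assumes "supported g (Pow (supp a)) i"
  shows "part i a' (embed i a g) = (if a' = a then g else 0)"
proof
  fix T
  show "part i a' (embed i a g) T = (if a' = a then g else 0) T"
  proof (cases "card T = i \<and> T \<subseteq> supp a \<and> T \<subseteq> supp a'")
    case True
    then have "a - ind T = a' - ind T \<longleftrightarrow> a' = a"
      using ind_add_diff[of T a] ind_add_diff[of T a'] by metis
    with True show ?thesis
      using subset_index[of T i] by (auto simp: part_def embed_def lookup_single when_def)
  next
    case False
    then show ?thesis using assms subset_index[of T i]
      by (auto simp: part_def embed_def supported_def)
  qed
qed

text \<open>Only finitely many strands of \<open>v\<close> are nonzero, so solutions found strand by
  strand can be added up. The family \<open>\<Delta>\<close> records where they live; thus the lemma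
  serves both S itself and an ideal.\<close>

lemma koszul_boundaryI:
  fixes v :: "nat \<Rightarrow> ('n::{finite,linorder}, 'k::field) mpoly"
  assumes v: "v \<in> free_mod (krank TYPE('n) i)"
    and ex: "\<And>a. \<exists>h. supported h (\<Delta> a \<inter> Pow (supp a)) (Suc i) \<and> kdiff h = part i a v"
  shows "\<exists>w. w \<in> free_mod (krank TYPE('n) (Suc i)) \<and> boundary (*) koszul i w = v \<and>
    (\<forall>a. supported (part (Suc i) a w) (\<Delta> a) (Suc i))"
proof -
  have "\<exists>H. \<forall>a. supported (H a) (\<Delta> a \<inter> Pow (supp a)) (Suc i) \<and> kdiff (H a) = part i a v"
    by (rule choice) (use ex in blast)
  then obtain H where H: "\<And>a. supported (H a) (\<Delta> a \<inter> Pow (supp a)) (Suc i)"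
    "\<And>a. kdiff (H a) = part i a v"
    by blast
  \<comment> \<open>Where the strand of \<open>v\<close> is 0, the solution 0 replaces the chosen
    one; this keeps the sum finite.\<close>
  define A where "A = {a. part i a v \<noteq> 0}"
  define w where "w = (\<lambda>k. \<Sum>a\<in>A. embed (Suc i) a (H a) k)"
  have fin: "finite A" unfolding A_def by (rule finite_parts)
  have pe: "part (Suc i) a (embed (Suc i) a' (H a')) = (if a = a' then H a' else 0)" for a a'
    by (rule part_embed) (use H(1)[of a'] in \<open>auto simp: supported_def\<close>)
  have pw: "part (Suc i) a w = (if a \<in> A then H a else 0)" for a
  proof
    fix T
    have "part (Suc i) a w T = (\<Sum>a'\<in>A. part (Suc i) a (embed (Suc i) a' (H a')) T)"
    proof (cases "card T = Suc i \<and> T \<subseteq> supp a")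
      case True
      then show ?thesis by (simp add: w_def part_def lookup_sum)
    next
      case False
      show ?thesis unfolding part_def if_not_P[OF False] by simp
    qed
    also have "\<dots> = (\<Sum>a'\<in>A. if a' = a then H a T else 0)"
      by (rule sum.cong) (auto simp: pe)
    finally show "part (Suc i) a w T = (if a \<in> A then H a else 0) T" using fin by simp
  qed
  have "boundary (*) koszul i w = v"
  proof (rule part_eqI[OF _ v])
    show "part i a (boundary (*) koszul i w) = part i a v" for a
      by (auto simp: part_boundary pw H(2) A_def)
  qed (auto simp: free_mod_def boundary_def)
  moreover have "w \<in> free_mod (krank TYPE('n) (Suc i))"
    by (simp add: w_def free_mod_def embed_def)
  moreover have "supported (part (Suc i) a w) (\<Delta> a) (Suc i)" for a
    using H(1)[of a] by (auto simp: pw supported_def)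
  ultimately show ?thesis by blast
qed

lemma exact_at_Pow:
  assumes "a \<noteq> 0"
  shows "exact_at (TYPE('k::field)) (Pow (supp a)) i"
proof -
  obtain x where "x \<in> supp a"
    using assms poly_mapping_eqI[of a 0] by (auto simp: in_keys_iff)
  then show ?thesis by (intro exact_at_cone[of _ x]) auto
qed

text \<open>For nonzero \<open>a\<close> the full simplex on \<open>supp a\<close> is a cone. In
  multidegree 0 it has no vertex and its empty face accounts for K, so that strand is required to
  vanish.\<close>

lemma koszul_boundaryI_free:
  fixes v :: "nat \<Rightarrow> ('n::{finite,linorder}, 'k::field) mpoly"
  assumes v: "v \<in> free_mod (krank TYPE('n) i)"
    and "\<And>a. kdiff (part i a v) = 0" and "part i 0 v = 0"
  shows "v \<in> boundary (*) koszul i ` free_mod (krank TYPE('n) (Suc i))"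
proof -
  have "\<exists>h. supported h (UNIV \<inter> Pow (supp a)) (Suc i) \<and> kdiff h = part i a v" for a
  proof (cases "a = 0")
    case True
    then show ?thesis using assms(3) by (intro exI[of _ 0]) simp
  next
    case False
    then show ?thesis
      using exact_at_Pow[of a, where 'k = 'k and i = i] supported_part[of i a v] assms(2)[of a]
      by (simp add: exact_at_def)
  qed
  from koszul_boundaryI[OF v this] show ?thesis by blast
qed

lemma koszul_boundary_boundary:
  fixes v :: "nat \<Rightarrow> ('n::{finite,linorder}, 'k::field) mpoly"
  shows "boundary (*) koszul i (boundary (*) koszul (Suc i) v) = 0"
  by (rule part_eqI[of _ i])
    (use boundary_free_mod[of _ "koszul :: ('n, 'k) free_complex"] in
      \<open>auto simp: part_boundary kdiff_kdiff zero_free_mod\<close>)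

lemma part_0_exponent: "part (Suc i) 0 v = 0"
  by (auto simp: part_def fun_eq_iff)

lemma krank_0: "krank TYPE('n::{finite,linorder}) 0 = 1"
proof -
  have "{T :: 'n set. card T = 0} = {{}}" by auto
  then show ?thesis by simp
qed

lemma koszul_augmentation:
  fixes v :: "nat \<Rightarrow> ('n::{finite,linorder}, 'k::field) mpoly"
  shows "augmentation koszul v = part 0 0 v {}"
proof -
  have "subset_index 0 ({} :: 'n set) = 0"
    using subset_index(1)[of "{} :: 'n set" 0] krank_0[where 'n = 'n] by simp
  then show ?thesis
    using krank_0[where 'n = 'n] by (simp add: augmentation_def part_def koszul_def)
qed

text \<open>Multidegree 0 occurs only in homological degree 0, where the augmentation reads off its
  single coefficient; all other strands are exact.\<close>

theorem koszul_resolves: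
  "resolves_residue_field (koszul :: ('n::{finite,linorder}, 'k::field) free_complex)"
  unfolding resolves_residue_field_def
proof (intro conjI allI impI)
  let ?K = "koszul :: ('n, 'k) free_complex"
  show "diff ?K i k l \<in> homogeneous (shift ?K (Suc i) l - shift ?K i k)" for i k l
  proof -
    have "(\<Sum>x\<in>X. if P x then Poly_Mapping.single (Poly_Mapping.single x 1) (c x) else 0)
        \<in> (homogeneous 1 :: ('n, 'k) mpoly set)" for X P c
    proof (induction X rule: infinite_finite_induct)
      case (insert x X)
      have "Poly_Mapping.single (Poly_Mapping.single x 1) (c x) \<in> (homogeneous 1 :: ('n, 'k) mpoly set)"
        using deg_ind[of "{x}"] by (auto simp: homogeneous_def ind_def)
      with insert show ?case by (auto intro: homogeneous_add)
    qed simp_all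
    then show ?thesis by (simp add: koszul_def)
  qed
  show "shift ?K 0 k = 0" for k by (simp add: koszul_def)
  show "augmentation ?K ` free_mod (rank ?K 0) = UNIV"
  proof (rule UNIV_eq_I[OF image_eqI, symmetric])
    have r: "rank ?K 0 = 1" by (simp only: rank_koszul krank_0)
    have a: "aug ?K k = 1" for k by (simp add: koszul_def)
    show "c = augmentation ?K (\<lambda>k. if k = 0 then const c else 0)" for c
      by (simp add: augmentation_def const_def r a del: rank_koszul)
    show "(\<lambda>k. if k = 0 then const c else 0) \<in> free_mod (rank ?K 0)" for c
      by (simp add: free_mod_def r del: rank_koszul)
  qed
  show "{v \<in> free_mod (rank ?K 0). augmentation ?K v = 0} = boundary (*) ?K 0 ` free_mod (rank ?K 1)"
  proof (intro equalityI subsetI)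
    fix v assume "v \<in> {v \<in> free_mod (rank ?K 0). augmentation ?K v = 0}"
    then have v: "v \<in> free_mod (krank TYPE('n) 0)" and "part 0 0 v {} = 0"
      by (auto simp: koszul_augmentation)
    then have "part 0 0 v = 0" by (auto simp: part_def fun_eq_iff)
    with koszul_boundaryI_free[OF v kdiff_supported_0[OF supported_part]]
    show "v \<in> boundary (*) ?K 0 ` free_mod (rank ?K 1)" by simp
  next
    fix v assume "v \<in> boundary (*) ?K 0 ` free_mod (rank ?K 1)"
    then obtain w where w: "v = boundary (*) ?K 0 w" by blast
    have "augmentation ?K v = 0"
      by (simp add: w koszul_augmentation part_boundary part_0_exponent)
    moreover have "v \<in> free_mod (rank ?K 0)" by (simp add: w free_mod_def boundary_def)
    ultimately show "v \<in> {v \<in> free_mod (rank ?K 0). augmentation ?K v = 0}" by simp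
  qed
  show "{v \<in> free_mod (rank ?K (Suc i)). boundary (*) ?K i v = (\<lambda>_. 0)} =
      boundary (*) ?K (Suc i) ` free_mod (rank ?K (Suc (Suc i)))" for i
  proof (intro equalityI subsetI)
    fix v assume "v \<in> {v \<in> free_mod (rank ?K (Suc i)). boundary (*) ?K i v = (\<lambda>_. 0)}"
    then have v: "v \<in> free_mod (krank TYPE('n) (Suc i))" and 0: "boundary (*) ?K i v = 0"
      by (auto simp: zero_fun_def)
    have "kdiff (part (Suc i) a v) = 0" for a
      using part_boundary[of i a v] 0 by simp
    from koszul_boundaryI_free[OF v this part_0_exponent]
    show "v \<in> boundary (*) ?K (Suc i) ` free_mod (rank ?K (Suc (Suc i)))" by simp
  next
    fix v assume "v \<in> boundary (*) ?K (Suc i) ` free_mod (rank ?K (Suc (Suc i)))"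
    then show "v \<in> {v \<in> free_mod (rank ?K (Suc i)). boundary (*) ?K i v = (\<lambda>_. 0)}"
      using koszul_boundary_boundary by (auto simp: free_mod_def boundary_def zero_fun_def)
  qed
qed

section \<open>Tor of monomial ideals\<close>

definition upper_koszul :: "('n::finite \<Rightarrow>\<^sub>0 nat) set \<Rightarrow> ('n \<Rightarrow>\<^sub>0 nat) \<Rightarrow> 'n set set"
  where "upper_koszul M a = {T. T \<subseteq> supp a \<and> a - ind T \<in> M}"

text \<open>Membership in a monomial ideal is tested term by term, hence strand by strand. The shift
  \<open>i\<close> is the degree of x^T, so internal degree \<open>j\<close> selects the
  multidegrees of total degree \<open>j\<close>.\<close>

lemma koszul_chains_iff:
  fixes I :: "('n::{finite,linorder}, 'k::field) mpoly set"
  assumes I: "\<And>p. p \<in> I \<longleftrightarrow> Poly_Mapping.keys p \<subseteq> M"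
  shows "v \<in> chains (\<lambda>d. I \<inter> homogeneous d) (koszul :: ('n, 'k) free_complex) i j \<longleftrightarrow>
    v \<in> free_mod (krank TYPE('n) i) \<and>
    (\<forall>a. supported (part i a v) (if int (deg a) = j then upper_koszul M a else {}) i)"
    (is "?L \<longleftrightarrow> ?F \<and> (\<forall>a. ?R a)")
proof (intro iffI conjI allI)
  assume v: ?L
  then show ?F by (simp add: chains_def)
  show "?R a" for a
    unfolding supported_def
  proof (intro allI impI)
    fix T assume "part i a v T \<noteq> 0"
    then have T: "card T = i" "T \<subseteq> supp a" "coeff (v (subset_index i T)) (a - ind T) \<noteq> 0"
      by (auto simp: part_def split: if_splits)
    have "v (subset_index i T) \<in> I" "v (subset_index i T) \<in> homogeneous (j - int i)"
      using v subset_index(1)[OF T(1)] by (auto simp: chains_def koszul_def)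
    then have "a - ind T \<in> M" "int (deg (a - ind T)) = j - int i"
      using T(3) by (auto simp: I in_keys_iff dest: homogeneous_coeff)
    moreover have "deg a = i + deg (a - ind T)"
      using deg_add[of "ind T" "a - ind T"] T by (simp add: ind_add_diff deg_ind)
    ultimately show "T \<in> (if int (deg a) = j then upper_koszul M a else {}) \<and> card T = i"
      using T by (simp add: upper_koszul_def)
  qed
next
  assume R: "?F \<and> (\<forall>a. ?R a)"
  have "v k \<in> I \<inter> homogeneous (j - shift (koszul :: ('n, 'k) free_complex) i k)" if k: "k < krank TYPE('n) i" for k
  proof -
    let ?T = "subset_enum i k :: 'n set"
    have *: "b \<in> M \<and> int (deg b) = j - int i" if "coeff (v k) b \<noteq> 0" for b
    proof -
      have "part i (ind ?T + b) v ?T \<noteq> 0" using that by (simp add: coeff_eq_part[OF k])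
      moreover have "?R (ind ?T + b)" using R by blast
      ultimately have "?T \<in> (if int (deg (ind ?T + b)) = j then upper_koszul M (ind ?T + b) else {})"
        by (simp add: supported_def)
      then show ?thesis
        using subset_enum(1)[OF k] by (auto simp: upper_koszul_def deg_add deg_ind split: if_splits)
    qed
    then show ?thesis by (auto simp: I koszul_def in_keys_iff intro!: homogeneousI)
  qed
  then show ?L using R by (simp add: chains_def)
qed

text \<open>Strands do not interact: a cycle on one strand is embedded and its bounding chain
  restricted to that strand; conversely, the bounding chains of all strands are added.\<close>

lemma koszul_Tor_vanishing_iff:
  fixes I :: "('n::{finite,linorder}, 'k::field) mpoly set"
  assumes ideal: "is_ideal I" and I: "\<And>p. p \<in> I \<longleftrightarrow> Poly_Mapping.keys p \<subseteq> M"
  shows "cycles (*) (\<lambda>d. I \<inter> homogeneous d) (koszul :: ('n, 'k) free_complex) i j = boundaries (*) (\<lambda>d. I \<inter> homogeneous d) (koszul :: ('n, 'k) free_complex) i j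
    \<longleftrightarrow> (\<forall>a. int (deg a) = j \<longrightarrow> exact_at TYPE('k) (upper_koszul M a) i)"
    (is "?C = ?B \<longleftrightarrow> (\<forall>a. _ a)")
proof (intro iffI allI impI)
  fix a :: "'n \<Rightarrow>\<^sub>0 nat" assume eq: "?C = ?B" and a: "int (deg a) = j"
  show "exact_at TYPE('k) (upper_koszul M a) i"
    unfolding exact_at_def
  proof (intro allI impI)
    fix g :: "'n set \<Rightarrow> 'k"
    assume g: "supported g (upper_koszul M a) i" and 0: "kdiff g = 0"
    let ?v = "embed i a g"
    have "supported g (Pow (supp a)) i" using g by (auto simp: supported_def upper_koszul_def)
    note pv = part_embed[OF this]
    have v: "?v \<in> chains (\<lambda>d. I \<inter> homogeneous d) (koszul :: ('n, 'k) free_complex) i j"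
      using g a by (simp add: koszul_chains_iff[OF I] embed_free_mod pv)
    have "?v \<in> ?C"
    proof (cases i)
      case (Suc m)
      have "boundary (*) koszul m ?v = 0"
      proof (rule part_eqI[of _ m])
        show "part m a' (boundary (*) koszul m ?v) = part m a' 0" for a'
          using 0 by (simp add: part_boundary pv Suc[symmetric])
      qed (use boundary_free_mod[of "(*)" "koszul :: ('n, 'k) free_complex" m] zero_free_mod in simp_all)
      then show ?thesis using v Suc by (simp add: zero_fun_def)
    qed (use v in simp)
    then obtain w where w: "w \<in> chains (\<lambda>d. I \<inter> homogeneous d) (koszul :: ('n, 'k) free_complex) (Suc i) j"
      "boundary (*) koszul i w = ?v"
      using eq by (auto simp: boundaries_def)
    have "supported (part (Suc i) a w) (upper_koszul M a) (Suc i)"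
      using w(1) a unfolding koszul_chains_iff[OF I] by (auto dest!: spec[of _ a])
    moreover have "kdiff (part (Suc i) a w) = g"
      using pv[of a] by (simp add: w(2) flip: part_boundary)
    ultimately show "\<exists>h. supported h (upper_koszul M a) (Suc i) \<and> kdiff h = g" by blast
  qed
next
  assume ex: "\<forall>a. int (deg a) = j \<longrightarrow> exact_at TYPE('k) (upper_koszul M a) i"
  show "?C = ?B"
  proof (rule antisym[OF subsetI boundaries_subset_cycles[OF koszul_resolves ideal]])
    fix v assume v: "v \<in> ?C"
    then have vc: "v \<in> chains (\<lambda>d. I \<inter> homogeneous d) (koszul :: ('n, 'k) free_complex) i j"
      using cycles_subset_chains by blast
    let ?\<Delta> = "\<lambda>a. if int (deg a) = j then upper_koszul M a else {}"
    have sup: "supported (part i a v) (?\<Delta> a) i" for a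
      using vc unfolding koszul_chains_iff[OF I] by blast
    have 0: "kdiff (part i a v) = 0" for a
    proof (cases i)
      case 0
      then show ?thesis using kdiff_supported_0 supported_part by metis
    next
      case (Suc m)
      then have "boundary (*) koszul m v = 0" using v by (simp add: zero_fun_def)
      then show ?thesis using part_boundary[of m a v] Suc by simp
    qed
    have "\<exists>h. supported h (?\<Delta> a \<inter> Pow (supp a)) (Suc i) \<and> kdiff h = part i a v" for a
    proof (cases "int (deg a) = j")
      case True
      have "upper_koszul M a \<inter> Pow (supp a) = upper_koszul M a" by (auto simp: upper_koszul_def)
      then show ?thesis using True ex sup[of a] 0[of a] by (simp add: exact_at_def)
    next
      case False
      then have "part i a v = 0" using sup[of a] by (auto simp: supported_def fun_eq_iff)
      then show ?thesis by (intro exI[of _ 0]) simp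
    qed
    from koszul_boundaryI[of v i, OF _ this] vc obtain w
      where w: "w \<in> free_mod (krank TYPE('n) (Suc i))" "boundary (*) koszul i w = v"
        "\<And>a. supported (part (Suc i) a w) (?\<Delta> a) (Suc i)"
      unfolding koszul_chains_iff[OF I] by blast
    then have "w \<in> chains (\<lambda>d. I \<inter> homogeneous d) (koszul :: ('n, 'k) free_complex) (Suc i) j"
      unfolding koszul_chains_iff[OF I] by blast
    then show "v \<in> ?B" using w(2) by (auto simp: boundaries_def)
  qed
qed

theorem betti_monomial_ideal_iff:
  fixes I :: "('n::{finite,linorder}, 'k::field) mpoly set"
  assumes "is_ideal I" and "\<And>p. p \<in> I \<longleftrightarrow> Poly_Mapping.keys p \<subseteq> M"
  shows "betti (*) (\<lambda>d. I \<inter> homogeneous d) i j \<noteq> 0 \<longleftrightarrow>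
    (\<exists>a. int (deg a) = j \<and> \<not> exact_at TYPE('k) (upper_koszul M a) i)"
  unfolding betti_nonzero_iff[OF koszul_resolves assms(1)] koszul_Tor_vanishing_iff[OF assms] by blast

section \<open>Exponent sets of monomial ideals\<close>

lemma le_imp_eq_add_diff:
  fixes a b :: "'n \<Rightarrow>\<^sub>0 nat"
  assumes "\<And>x. Poly_Mapping.lookup a x \<le> Poly_Mapping.lookup b x"
  shows "b = a + (b - a)"
  by (rule poly_mapping_eqI) (simp add: lookup_add lookup_minus assms)

definition upset :: "('n \<Rightarrow>\<^sub>0 nat) set \<Rightarrow> ('n \<Rightarrow>\<^sub>0 nat) set"
  where "upset A = {a + c | a c. a \<in> A}"

lemma in_upset_iff:
  "b \<in> upset A \<longleftrightarrow> (\<exists>a\<in>A. \<forall>x. Poly_Mapping.lookup a x \<le> Poly_Mapping.lookup b x)"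
proof
  show "b \<in> upset A \<Longrightarrow> \<exists>a\<in>A. \<forall>x. Poly_Mapping.lookup a x \<le> Poly_Mapping.lookup b x"
    by (force simp: upset_def lookup_add)
  show "\<exists>a\<in>A. \<forall>x. Poly_Mapping.lookup a x \<le> Poly_Mapping.lookup b x \<Longrightarrow> b \<in> upset A"
    unfolding upset_def using le_imp_eq_add_diff[of _ b] by blast
qed

lemma upset_mono_le:
  "a \<in> upset A \<Longrightarrow> (\<And>x. Poly_Mapping.lookup a x \<le> Poly_Mapping.lookup b x) \<Longrightarrow> b \<in> upset A"
  unfolding in_upset_iff by (meson le_trans)

lemma keys_monom [simp]: "Poly_Mapping.keys (monom a :: ('n, 'k::zero_neq_one) mpoly) = {a}"
  by (simp add: monom_def)

lemma monom_add: "monom (a + b) = monom a * (monom b :: ('n, 'k::field) mpoly)"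
  by (simp add: monom_def mult_single)

text \<open>The exponents in \<open>upset A\<close> are closed under adding any exponent, so the
  polynomials supported there form an ideal containing the generators; conversely, each of their
  terms is a multiple of a generator.\<close>

lemma in_ideal_gen_monom_iff:
  fixes p :: "('n, 'k::field) mpoly"
  shows "p \<in> ideal_gen (monom ` A) \<longleftrightarrow> Poly_Mapping.keys p \<subseteq> upset A"
proof
  let ?U = "{p :: ('n, 'k) mpoly. Poly_Mapping.keys p \<subseteq> upset A}"
  have "is_ideal ?U"
    unfolding is_ideal_iff
  proof (intro conjI ballI allI)
    show "x + y \<in> ?U" if "x \<in> ?U" "y \<in> ?U" for x y
      using that keys_add[of x y] by blast
    show "c * x \<in> ?U" if x: "x \<in> ?U" for c x
    proof -
      have "b + a \<in> upset A" if "a \<in> upset A" for a b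
        by (rule upset_mono_le[OF that]) (simp add: lookup_add)
      then show ?thesis using x keys_mult[of c x] by blast
    qed
  qed simp
  moreover have "monom ` A \<subseteq> ?U" by (auto simp: in_upset_iff)
  ultimately have "ideal_gen (monom ` A) \<subseteq> ?U" by (rule module.span_minimal[OF module_mult, rotated])
  then show "p \<in> ideal_gen (monom ` A) \<Longrightarrow> Poly_Mapping.keys p \<subseteq> upset A" by blast
next
  assume p: "Poly_Mapping.keys p \<subseteq> upset A"
  have "const (coeff p b) * monom b \<in> ideal_gen (monom ` A)" if b: "b \<in> Poly_Mapping.keys p" for b
  proof -
    obtain a c where "b = a + c" "a \<in> A" using b p by (auto simp: upset_def)
    then have "const (coeff p b) * monom b = (const (coeff p b) * monom c) * monom a"
      by (simp add: monom_add)
    then show ?thesis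
      using module.span_scale[OF module_mult module.span_base[OF module_mult]] \<open>a \<in> A\<close>
      by (metis imageI)
  qed
  then show "p \<in> ideal_gen (monom ` A)"
    by (subst poly_eq_sum_monom) (rule module.span_sum[OF module_mult])
qed

lemma is_ideal_gen: "is_ideal (ideal_gen A)"
  by (rule module.subspace_span[OF module_mult])

section \<open>Dilation of exponents and bracket powers\<close>

definition dilate :: "nat \<Rightarrow> ('n \<Rightarrow>\<^sub>0 nat) \<Rightarrow> 'n \<Rightarrow>\<^sub>0 nat"
  where "dilate q a = Poly_Mapping.map ((*) q) a"

lemma lookup_dilate: "Poly_Mapping.lookup (dilate q a) x = q * Poly_Mapping.lookup a x"
  by (simp add: dilate_def map.rep_eq when_def)

lemma deg_dilate: "deg (dilate q a) = q * deg a"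
  by (simp add: deg_def lookup_dilate sum_distrib_left)

lemma monom_power: "(monom a :: ('n, 'k::field) mpoly) ^ q = monom (dilate q a)"
proof (induction q)
  case 0
  have "dilate 0 a = 0" by (rule poly_mapping_eqI) (simp add: lookup_dilate)
  then show ?case by (simp add: monom_def)
next
  case (Suc q)
  have "dilate (Suc q) a = a + dilate q a"
    by (rule poly_mapping_eqI) (simp add: lookup_dilate lookup_add)
  with Suc show ?case by (simp add: monom_add)
qed

text \<open>\<open>bracket_power\<close> uses the powers of all monomials of the ideal, so the
  exponents dilated are those of \<open>upset A\<close> and not just of \<open>A\<close>.\<close>

lemma bracket_power_monomial:
  fixes A :: "('n \<Rightarrow>\<^sub>0 nat) set"
  shows "bracket_power (ideal_gen (monom ` A) :: ('n, 'k::field) mpoly set) q =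
    ideal_gen (monom ` dilate q ` upset A)"
proof -
  have "{u ^ q | u. u \<in> ideal_gen (monom ` A) \<and> u \<in> range monom} =
      (monom ` dilate q ` upset A :: ('n, 'k) mpoly set)"
    by (auto simp: in_ideal_gen_monom_iff monom_power intro!: exI imageI)
  then show ?thesis by (simp add: bracket_power_def)
qed

text \<open>Off \<open>T\<close> the factor q cancels. On \<open>T\<close> the coordinates of
  \<open>a\<close> are positive, and q b <= q a - 1 means q b < q a, that is b <= a - 1. So lowering
  by 1 before or after dilation gives the same divisibility test.\<close>

lemma upper_koszul_dilate:
  assumes q: "q > 0"
  shows "upper_koszul (upset (dilate q ` upset A)) (dilate q a) = upper_koszul (upset A) a"
proof -
  have supp: "supp (dilate q a) = supp a" using q by (auto simp: in_keys_iff lookup_dilate)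
  have "dilate q a - ind T \<in> upset (dilate q ` upset A) \<longleftrightarrow> a - ind T \<in> upset A"
    if T: "T \<subseteq> supp a" for T
  proof
    assume "dilate q a - ind T \<in> upset (dilate q ` upset A)"
    then obtain b where b: "b \<in> upset A"
      "\<And>x. q * Poly_Mapping.lookup b x \<le> q * Poly_Mapping.lookup a x - (if x \<in> T then 1 else 0)"
      by (auto simp: in_upset_iff[of _ "dilate q ` upset A"] lookup_dilate lookup_minus lookup_ind)
    show "a - ind T \<in> upset A"
    proof (rule upset_mono_le[OF b(1)])
      fix x
      show "Poly_Mapping.lookup b x \<le> Poly_Mapping.lookup (a - ind T) x"
      proof (cases "x \<in> T")
        case True
        then have "Poly_Mapping.lookup a x > 0" using T by (auto simp: in_keys_iff)
        then have "q * Poly_Mapping.lookup b x < q * Poly_Mapping.lookup a x"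
          using b(2)[of x] True q by (simp add: le_diff_conv2 Suc_le_eq)
        then have "Poly_Mapping.lookup b x < Poly_Mapping.lookup a x" by simp
        then show ?thesis using True by (auto simp: lookup_minus lookup_ind)
      next
        case False
        then show ?thesis using b(2)[of x] q by (simp add: lookup_minus lookup_ind)
      qed
    qed
  next
    assume a: "a - ind T \<in> upset A"
    \<comment> \<open>On \<open>T\<close> this reads q a - q <= q a - 1, by q > 0.\<close>
    have "Poly_Mapping.lookup (dilate q (a - ind T)) x \<le> Poly_Mapping.lookup (dilate q a - ind T) x" for x
    proof (cases "x \<in> T")
      case True
      then show ?thesis using q by (simp add: lookup_dilate lookup_minus lookup_ind diff_mult_distrib2)
    qed (simp add: lookup_dilate lookup_minus lookup_ind)
    then show "dilate q a - ind T \<in> upset (dilate q ` upset A)"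
      using a in_upset_iff by blast
  qed
  then show ?thesis by (auto simp: upper_koszul_def supp)
qed

section \<open>Finiteness of the regularity\<close>

text \<open>If the monotone subsequence decreases, it reaches a least value and stays there, and
  this constant tail counts as increasing.\<close>

lemma nat_seq_incseq_subseq:
  fixes f :: "nat \<Rightarrow> nat"
  obtains r where "strict_mono r" "incseq (f \<circ> r)"
proof -
  obtain r where r: "strict_mono r" "monoseq (f \<circ> r)" using seq_monosub[of f] by (auto simp: comp_def)
  show thesis
  proof (cases "incseq (f \<circ> r)")
    case True
    then show thesis using that r by blast
  next
    case False
    then have dec: "decseq (f \<circ> r)" using r(2) by (simp add: monoseq_iff)
    obtain m where m: "\<And>n. (f \<circ> r) m \<le> (f \<circ> r) n"
      using ex_has_least_nat[of "\<lambda>_. True" 0 "f \<circ> r"] by blast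
    have "(f \<circ> r) (m + n) = (f \<circ> r) m" for n
      using decseqD[OF dec, of m "m + n"] m[of "m + n"] by simp
    then have "incseq (f \<circ> (\<lambda>n. r (m + n)))" by (simp add: incseq_def)
    moreover have "strict_mono (\<lambda>n. r (m + n))" using r(1) by (simp add: strict_mono_def)
    ultimately show thesis using that by blast
  qed
qed

text \<open>Coordinates are treated in turn: a further subsequence keeps the earlier ones
  increasing.\<close>

lemma incseq_subseq_coordinates:
  fixes f :: "nat \<Rightarrow> 'n \<Rightarrow>\<^sub>0 nat"
  assumes "finite X"
  shows "\<exists>r. strict_mono r \<and> (\<forall>x\<in>X. incseq (\<lambda>n. Poly_Mapping.lookup (f (r n)) x))"
  using assms
proof (induction X)
  case empty
  show ?case by (intro exI[of _ "\<lambda>n. n"]) (simp add: strict_mono_def)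
next
  case (insert y X)
  then obtain r where r: "strict_mono r" "\<And>x. x \<in> X \<Longrightarrow> incseq (\<lambda>n. Poly_Mapping.lookup (f (r n)) x)"
    by auto
  obtain s where s: "strict_mono s" "incseq ((\<lambda>n. Poly_Mapping.lookup (f (r n)) y) \<circ> s)"
    using nat_seq_incseq_subseq by blast
  have "strict_mono (r \<circ> s)" using r(1) s(1) by (rule strict_mono_o)
  moreover have "incseq (\<lambda>n. Poly_Mapping.lookup (f ((r \<circ> s) n)) x)" if "x \<in> insert y X" for x
  proof (cases "x = y")
    case True
    then show ?thesis using s(2) by (simp add: comp_def)
  next
    case False
    then show ?thesis using that r(2)[of x] strict_mono_mono[OF s(1)] by (auto simp: incseq_def mono_def)
  qed
  ultimately show ?case by blast
qed

text \<open>\<open>S\<close> collects the exponents minimal under divisibility. Were it infinite, a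
  sequence in it increasing in every coordinate would give two distinct comparable elements, against
  minimality.\<close>

lemma dickson:
  fixes A :: "('n::finite \<Rightarrow>\<^sub>0 nat) set"
  obtains S where "finite S" "S \<subseteq> A" "upset S = upset A"
proof
  define le where "le a b \<longleftrightarrow> (\<forall>x. Poly_Mapping.lookup a x \<le> Poly_Mapping.lookup b x)"
    for a b :: "'n \<Rightarrow>\<^sub>0 nat"
  define S where "S = {a \<in> A. \<forall>b\<in>A. le b a \<longrightarrow> b = a}"
  show "S \<subseteq> A" by (auto simp: S_def)
  have "\<exists>b\<in>S. le b a" if "a \<in> A" for a
    using that
  \<comment> \<open>Descent to a minimal exponent: a proper divisor has smaller degree.\<close>
  proof (induction "deg a" arbitrary: a rule: less_induct)
    case less
    show ?case
    proof (cases "a \<in> S")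
      case False
      then obtain b where b: "b \<in> A" "le b a" "b \<noteq> a" using less.prems by (auto simp: S_def)
      then have a_eq: "a = b + (a - b)" by (intro le_imp_eq_add_diff) (simp add: le_def)
      have "deg (a - b) \<noteq> 0"
      proof
        assume "deg (a - b) = 0"
        then have "a - b = 0" by (intro poly_mapping_eqI) (simp add: deg_def)
        then show False using a_eq b(3) by simp
      qed
      then have "deg b < deg a" using arg_cong[OF a_eq, of deg] by (simp add: deg_add)
      from less.hyps[OF this b(1)] b(2) show ?thesis unfolding le_def by (meson le_trans)
    qed (auto simp: le_def)
  qed
  then show "upset S = upset A"
    using \<open>S \<subseteq> A\<close> unfolding set_eq_iff in_upset_iff le_def by (meson le_trans subsetD)
  show "finite S"
  proof (rule ccontr)
    assume "infinite S"
    then obtain f :: "nat \<Rightarrow> 'n \<Rightarrow>\<^sub>0 nat" where f: "inj f" "range f \<subseteq> S"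
      using infinite_countable_subset by blast
    obtain r where r: "strict_mono r" "\<And>x. incseq (\<lambda>n. Poly_Mapping.lookup (f (r n)) x)"
      using incseq_subseq_coordinates[OF finite[of UNIV], of f] by blast
    have "le (f (r 0)) (f (r 1))" using r(2) by (simp add: le_def incseq_def)
    moreover have "f (r 0) \<in> S" "f (r 1) \<in> S" using f(2) by auto
    ultimately have "f (r 0) = f (r 1)" unfolding S_def by blast
    then have "r 0 = r 1" using f(1) by (simp add: inj_eq)
    then show False using strict_monoD[OF r(1), of 0 1] by simp
  qed
qed

lemma exact_at_large:
  assumes "i > CARD('n)"
  shows "exact_at TYPE('k::field) (\<Delta> :: 'n::{finite,linorder} set set) i"
proof -
  have "card T \<noteq> i" for T :: "'n set"
    using assms card_mono[of "UNIV :: 'n set" T] by auto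
  then have "g = 0" if "supported g \<Delta> i" for g :: "'n set \<Rightarrow> 'k"
    using that by (auto simp: supported_def fun_eq_iff)
  then show ?thesis unfolding exact_at_def by (metis kdiff_0 supported_0)
qed

text \<open>In a multidegree not dividing the lcm of the generators, the complex is a cone.\<close>

lemma upper_koszul_exact_bound:
  fixes A :: "('n::{finite,linorder} \<Rightarrow>\<^sub>0 nat) set"
  obtains N where "\<And>a i. \<not> exact_at TYPE('k::field) (upper_koszul (upset A) a) i \<Longrightarrow> deg a \<le> N"
proof -
  obtain S where S: "finite S" "S \<subseteq> A" "upset S = upset A" by (rule dickson)
  \<comment> \<open>The sum bounds the exponent of \<open>x\<close> in every generator, hence also
    that in their lcm.\<close>
  define L where "L x = (\<Sum>s\<in>S. Poly_Mapping.lookup s x)" for x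
  have L: "Poly_Mapping.lookup s x \<le> L x" if "s \<in> S" for s x
    unfolding L_def using S(1) that by (intro member_le_sum) auto
  have "Poly_Mapping.lookup a x \<le> L x" if "\<not> exact_at TYPE('k) (upper_koszul (upset A) a) i" for a i x
  proof (rule ccontr)
    assume x: "\<not> Poly_Mapping.lookup a x \<le> L x"
    have "insert x T \<in> upper_koszul (upset A) a" if "T \<in> upper_koszul (upset A) a" for T
    proof -
      have T: "T \<subseteq> supp a" "a - ind T \<in> upset S" using that S by (auto simp: upper_koszul_def)
      then obtain s where s: "s \<in> S" "\<And>y. Poly_Mapping.lookup s y \<le> Poly_Mapping.lookup (a - ind T) y"
        by (auto simp: in_upset_iff)
      \<comment> \<open>Coordinate \<open>x\<close> of \<open>a\<close> exceeds that of
        \<open>s\<close>, so it can be lowered by one and still dominate.\<close>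
      have "Poly_Mapping.lookup s y \<le> Poly_Mapping.lookup (a - ind (insert x T)) y" for y
        using s(2)[of y] L[OF s(1), of x] x by (auto simp: lookup_minus lookup_ind)
      then have "a - ind (insert x T) \<in> upset S" using s(1) in_upset_iff by blast
      then show ?thesis using T x S by (auto simp: upper_koszul_def in_keys_iff)
    qed
    then have "exact_at TYPE('k) (upper_koszul (upset A) a) i" by (rule exact_at_cone)
    with that show False by blast
  qed
  then have "deg a \<le> (\<Sum>x\<in>UNIV. L x)"
    if "\<not> exact_at TYPE('k) (upper_koszul (upset A) a) i" for a i
    unfolding deg_def using that by (intro sum_mono) blast
  then show thesis using that by blast
qed

section \<open>Attained maxima and the inequality\<close>

abbreviation betti_support :: "('n::finite, 'k::field) mpoly set \<Rightarrow> int set"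
  where "betti_support I \<equiv> {j - int i | i j. betti (*) (\<lambda>d. I \<inter> homogeneous d) i j \<noteq> 0}"

lemma betti_ideal_gen_monom_iff:
  fixes A :: "('n::{finite,linorder} \<Rightarrow>\<^sub>0 nat) set"
  shows "betti (*) (\<lambda>d. ideal_gen (monom ` A :: ('n, 'k::field) mpoly set) \<inter> homogeneous d) i j \<noteq> 0 \<longleftrightarrow>
    (\<exists>a. int (deg a) = j \<and> \<not> exact_at TYPE('k) (upper_koszul (upset A) a) i)"
  by (rule betti_monomial_ideal_iff[OF is_ideal_gen in_ideal_gen_monom_iff])

text \<open>No face has more vertices than there are variables, and multidegrees with homology have
  bounded degree, so j - i is bounded on both sides.\<close>

lemma finite_betti_support:
  fixes A :: "('n::{finite,linorder} \<Rightarrow>\<^sub>0 nat) set"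
  shows "finite (betti_support (ideal_gen (monom ` A :: ('n, 'k::field) mpoly set)))"
proof -
  obtain N where N: "\<And>a i. \<not> exact_at TYPE('k) (upper_koszul (upset A) a) i \<Longrightarrow> deg a \<le> N"
    using upper_koszul_exact_bound[where 'k = 'k] by blast
  have "betti_support (ideal_gen (monom ` A :: ('n, 'k) mpoly set)) \<subseteq> {- int CARD('n)..int N}"
  proof
    fix d assume "d \<in> betti_support (ideal_gen (monom ` A :: ('n, 'k) mpoly set))"
    then obtain i a where d: "d = int (deg a) - int i"
      and ne: "\<not> exact_at TYPE('k) (upper_koszul (upset A) a) i"
      unfolding betti_ideal_gen_monom_iff by blast
    have "i \<le> CARD('n)" using ne exact_at_large[of i, where 'n = 'n and 'k = 'k] by (meson not_le)
    with N[OF ne] d show "d \<in> {- int CARD('n)..int N}" by simp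
  qed
  then show ?thesis by (rule finite_subset) simp
qed

text \<open>A monomial of least degree in the ideal is a minimal generator and so shows up in
  Tor_0.\<close>

lemma betti_support_nonempty:
  fixes A :: "('n::{finite,linorder} \<Rightarrow>\<^sub>0 nat) set"
  assumes "A \<noteq> {}"
  shows "betti_support (ideal_gen (monom ` A :: ('n, 'k::field) mpoly set)) \<noteq> {}"
proof -
  obtain a where "a \<in> upset A" using assms by (auto simp: upset_def)
  then obtain a where a: "a \<in> upset A" "\<And>b. b \<in> upset A \<Longrightarrow> deg a \<le> deg b"
    using ex_has_least_nat[of "\<lambda>a. a \<in> upset A" a deg] by blast
  have "\<not> exact_at TYPE('k) (upper_koszul (upset A) a) 0"
  proof
    assume ex: "exact_at TYPE('k) (upper_koszul (upset A) a) 0"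
    \<comment> \<open>The empty face is a cycle; a chain bounding it would need a vertex of the
      complex, that is, a monomial of the ideal of degree one less.\<close>
    define g :: "'n set \<Rightarrow> 'k" where "g = (\<lambda>T. if T = {} then 1 else 0)"
    have g: "supported g (upper_koszul (upset A) a) 0"
      using a(1) by (simp add: supported_def g_def upper_koszul_def)
    then obtain h where h: "supported h (upper_koszul (upset A) a) (Suc 0)" "kdiff h = g"
      using ex kdiff_supported_0[OF g] unfolding exact_at_def by blast
    have "h T = 0" for T
    proof (rule ccontr)
      assume "h T \<noteq> 0"
      then have T: "T \<subseteq> supp a" "a - ind T \<in> upset A" "card T = Suc 0"
        using h(1) by (auto simp: supported_def upper_koszul_def)
      have "deg a = card T + deg (a - ind T)"
        using deg_add[of "ind T" "a - ind T"] T by (simp add: ind_add_diff deg_ind)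
      then show False using a(2)[OF T(2)] T(3) by simp
    qed
    then have "h = 0" by (auto simp: fun_eq_iff)
    then have "g {} = 0" using h(2) by auto
    then show False by (simp add: g_def)
  qed
  then have "betti (*) (\<lambda>d. ideal_gen (monom ` A :: ('n, 'k) mpoly set) \<inter> homogeneous d) 0 (int (deg a)) \<noteq> 0"
    unfolding betti_ideal_gen_monom_iff by blast
  then show ?thesis by blast
qed

theorem theorem2p6:
  fixes I :: "('n::{finite,linorder}, 'k::field) mpoly set" and q :: nat
  assumes "infinite (UNIV :: 'k set)"
    and "CARD('n) \<ge> 2"
    and "I \<noteq> {0}"
    and "I \<noteq> UNIV"
    and "borel_type I"
    and "q > 0"
  shows "ideal_reg (bracket_power I q) \<ge> int q * ideal_reg I"
proof -
  have "monomial_ideal I" using \<open>borel_type I\<close> unfolding borel_type_def by (rule conjunct1)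
  then obtain A where I: "I = ideal_gen (monom ` A)" unfolding monomial_ideal_def ..
  let ?J = "ideal_gen (monom ` dilate q ` upset A) :: ('n, 'k) mpoly set"
  have "A \<noteq> {}"
  proof
    assume "A = {}"
    then have "I = {0}" unfolding I by (simp only: image_empty module.span_empty[OF module_mult])
    with \<open>I \<noteq> {0}\<close> show False ..
  qed
  \<comment> \<open>For \<open>I\<close> the maximum must be attained, as it supplies the
    multidegree; for the bracket power one element of the finite set bounds \<open>Max\<close> from
    below.\<close>
  then have "Max (betti_support I) \<in> betti_support I"
    unfolding I by (intro Max_in finite_betti_support betti_support_nonempty)
  then obtain i a where reg: "Max (betti_support I) = int (deg a) - int i"
    and ne: "\<not> exact_at TYPE('k) (upper_koszul (upset A) a) i"
    unfolding I betti_ideal_gen_monom_iff by blast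
  have "int (q * deg a) - int i \<in> betti_support ?J"
    unfolding betti_ideal_gen_monom_iff
    by (intro CollectI exI[of _ i] exI[of _ "int (q * deg a)"] conjI refl exI[of _ "dilate q a"])
      (simp_all add: ne deg_dilate upper_koszul_dilate[OF \<open>q > 0\<close>])
  then have "int (q * deg a) - int i \<le> Max (betti_support ?J)"
    by (intro Max_ge finite_betti_support)
  moreover have "int q * (int (deg a) - int i) \<le> int (q * deg a) - int i"
  proof -
    have "int i \<le> int q * int i" using \<open>q > 0\<close> by (simp add: mult_le_cancel_right1)
    then show ?thesis by (simp add: right_diff_distrib)
  qed
  moreover have "bracket_power I q = ?J"
    unfolding I by (rule bracket_power_monomial)
  ultimately show ?thesis
    unfolding ideal_reg_def regularity_def by (simp only: reg)
qed

end
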